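(* Let $f: X \to X$ be a nonexpansive map on a real Banach space $X$. Consider the following possible conditions on $f$. (a) The approximate fixed point sets $F_\delta(f)$ are bounded for all $\delta>0$. (b) $f+u$ has a nonempty and bounded set of fixed points for all $u\in X$. (c) $f-\mathrm{id}$ maps onto $X$. (d) The range of $f-\mathrm{id}$ is dense in $X$. (e) For every $x\in X$ with $\|x\|=1$, there is an $x^*\in J(x)$ such that $\lim_{t\to\infty}\langle f(tx)-tx,x^*\rangle=-\infty$. Then the following implications are true. (i) Condition (a) implies (d), (b) implies (c), and (d) implies (e). (ii) If $X$ has the fixed point property, then (a) implies (b). (iii) If $X$ is uniformly smooth, then conditions (d) and (e) are equivalent. (iv) If $X$ is a Hilbert space, then conditions (b) and (c) are equivalent. (v) If $X$ is finite dimensional with a smooth or polyhedral norm, then all five conditions (a)–(e) are equivalent.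
   Context: A map $f:X\to X$ is nonexpansive if $\|f(x)-f(y)\|\le\|x-y\|$ for all $x,y\in X$. For $\delta\ge0$, $F_\delta(f)=\{x\in X:\|f(x)-x\|\le\delta\}$. $f+u$ denotes the map $x\mapsto f(x)+u$, and $\mathrm{id}$ the identity. $X^*$ is the dual space with dual norm $\|\cdot\|_*$ and $\langle x,x^*\rangle$ is the value of $x^*\in X^*$ at $x\in X$. The duality map is $J(x)=\{x^*\in X^*:\|x^*\|_*=\|x\|,\ \langle x,x^*\rangle=\|x\|\,\|x^*\|_*\}$. $X$ has the fixed point property if for every closed, bounded, convex (nonempty) subset $C\subset X$, every nonexpansive map $C\to C$ has a fixed point. $X$ is strictly convex if $\|x+y\|<2$ whenever $x\ne y$ and $\|x\|=\|y\|=1$; uniformly convex if for every $0<\epsilon\le2$ there is $\delta>0$ such that $\|x\|=\|y\|=1$ and $\|x-y\|\ge\epsilon$ imply $\|x+y\|\le2-\delta$. $X$ is smooth if $X^*$ is strictly convex, and uniformly smooth if $X^*$ is uniformly convex. A norm is polyhedral if its closed unit ball is a convex polytope, i.e. has finitely many extreme points (in finite dimensions). *)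

theory Defs
  imports "HOL-Analysis.Analysis"
begin

definition nonexpansive_on :: "'a::real_normed_vector set \<Rightarrow> ('a \<Rightarrow> 'a) \<Rightarrow> bool" where
  "nonexpansive_on C f \<longleftrightarrow> (\<forall>x\<in>C. \<forall>y\<in>C. norm (f x - f y) \<le> norm (x - y))"

definition approx_fixed_points :: "real \<Rightarrow> ('a::real_normed_vector \<Rightarrow> 'a) \<Rightarrow> 'a set" where
  "approx_fixed_points \<delta> f = {x. norm (f x - x) \<le> \<delta>}"

text \<open>
  The dual space is the type \<open>'a \<Rightarrow>\<^sub>L real\<close> of bounded linear functionals, whose norm is
  the operator norm.
\<close>

definition duality_map :: "'a::real_normed_vector \<Rightarrow> ('a \<Rightarrow>\<^sub>L real) set" where
  "duality_map x =
    {\<phi>. norm \<phi> = norm x \<and> blinfun_apply \<phi> x = norm x * norm \<phi>}"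

text \<open>
  Properties of the whole space are predicates on its type, so that they can also be applied
  to the dual.
\<close>

definition fixed_point_property :: "'a::real_normed_vector itself \<Rightarrow> bool" where
  "fixed_point_property _ \<longleftrightarrow>
    (\<forall>(C :: 'a set) g. C \<noteq> {} \<and> closed C \<and> bounded C \<and> convex C \<and>
       g \<in> C \<rightarrow> C \<and> nonexpansive_on C g \<longrightarrow> (\<exists>x\<in>C. g x = x))"

definition strictly_convex_space :: "'a::real_normed_vector itself \<Rightarrow> bool" where
  "strictly_convex_space _ \<longleftrightarrow>
    (\<forall>x y :: 'a. x \<noteq> y \<and> norm x = 1 \<and> norm y = 1 \<longrightarrow> norm (x + y) < 2)"

definition uniformly_convex_space :: "'a::real_normed_vector itself \<Rightarrow> bool" where
  "uniformly_convex_space _ \<longleftrightarrow>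
    (\<forall>\<epsilon>::real. 0 < \<epsilon> \<and> \<epsilon> \<le> 2 \<longrightarrow>
       (\<exists>\<delta>>0. \<forall>x y :: 'a. norm x = 1 \<and> norm y = 1 \<and> norm (x - y) \<ge> \<epsilon> \<longrightarrow>
          norm (x + y) \<le> 2 - \<delta>))"

definition smooth_space :: "'a::real_normed_vector itself \<Rightarrow> bool" where
  "smooth_space _ \<longleftrightarrow> strictly_convex_space TYPE('a \<Rightarrow>\<^sub>L real)"

definition uniformly_smooth_space :: "'a::real_normed_vector itself \<Rightarrow> bool" where
  "uniformly_smooth_space _ \<longleftrightarrow> uniformly_convex_space TYPE('a \<Rightarrow>\<^sub>L real)"

text \<open>
  The class \<open>real_inner\<close> cannot serve as a hypothesis on a given normed space, so the
  inner product is existentially quantified; completeness comes from the class \<open>banach\<close>.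
\<close>

definition hilbert_space :: "'a::banach itself \<Rightarrow> bool" where
  "hilbert_space _ \<longleftrightarrow>
    (\<exists>ip :: 'a \<Rightarrow> 'a \<Rightarrow> real.
       (\<forall>x y. ip x y = ip y x) \<and>
       (\<forall>x y z. ip (x + y) z = ip x z + ip y z) \<and>
       (\<forall>r x y. ip (r *\<^sub>R x) y = r * ip x y) \<and>
       (\<forall>x. 0 \<le> ip x x) \<and>
       (\<forall>x. ip x x = 0 \<longleftrightarrow> x = 0) \<and>
       (\<forall>x. norm x = sqrt (ip x x)))"

definition finite_dimensional_space :: "'a::real_normed_vector itself \<Rightarrow> bool" where
  "finite_dimensional_space _ \<longleftrightarrow> (\<exists>B :: 'a set. finite B \<and> span B = UNIV)"

definition polyhedral_norm :: "'a::real_normed_vector itself \<Rightarrow> bool" where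
  "polyhedral_norm _ \<longleftrightarrow> polytope (cball (0 :: 'a) 1)"

definition approx_fixed_points_bounded :: "('a::real_normed_vector \<Rightarrow> 'a) \<Rightarrow> bool" where
  "approx_fixed_points_bounded f \<longleftrightarrow> (\<forall>\<delta>>0. bounded (approx_fixed_points \<delta> f))"

definition translates_have_bounded_fixed_points :: "('a::real_normed_vector \<Rightarrow> 'a) \<Rightarrow> bool" where
  "translates_have_bounded_fixed_points f \<longleftrightarrow>
    (\<forall>u. {x. f x + u = x} \<noteq> {} \<and> bounded {x. f x + u = x})"

definition displacement_onto :: "('a::real_normed_vector \<Rightarrow> 'a) \<Rightarrow> bool" where
  "displacement_onto f \<longleftrightarrow> surj (\<lambda>x. f x - x)"

definition displacement_dense_range :: "('a::real_normed_vector \<Rightarrow> 'a) \<Rightarrow> bool" where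
  "displacement_dense_range f \<longleftrightarrow> closure (range (\<lambda>x. f x - x)) = UNIV"

definition displacement_radially_inward :: "('a::real_normed_vector \<Rightarrow> 'a) \<Rightarrow> bool" where
  "displacement_radially_inward f \<longleftrightarrow>
    (\<forall>x. norm x = 1 \<longrightarrow>
       (\<exists>\<phi>\<in>duality_map x.
          filterlim (\<lambda>t::real. blinfun_apply \<phi> (f (t *\<^sub>R x) - t *\<^sub>R x)) at_bot at_top))"

end

theory Submission
  imports Defs
begin

text \<open>
Everything rests on one inequality. If \<open>\<phi>\<close> has norm at most one and norms \<open>x - y\<close>, that is,
\<open>\<phi> (x - y) = \<parallel>x - y\<parallel>\<close>, then nonexpansiveness gives \<open>\<phi> (f x - x) \<le> \<phi> (f y - y)\<close>: the displacement
\<open>f - id\<close> is dissipative. Banach's contraction principle supplies the resolvent points, the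
solutions of \<open>g x - x = s x\<close> for \<open>s > 0\<close>, where \<open>g = f + u\<close>.

(a) implies (d): the products \<open>s \<parallel>x\<parallel>\<close> at resolvent points are bounded by \<open>\<parallel>g 0\<parallel>\<close>, so these points
lie in a single approximate fixed point set; if that set is bounded, the displacements \<open>s x\<close> of
\<open>g\<close> tend to \<open>0\<close> as \<open>s\<close> does. That (b) implies (c) is a rearrangement.

(d) implies (e): for a unit vector \<open>v\<close> the function \<open>radial v y = lim (\<parallel>s v + y\<parallel> - s)\<close>, the one-sided
derivative of the norm at \<open>v\<close>, is sublinear, and by Hahn-Banach it is at every \<open>y\<close> the value of some
\<open>\<phi>\<close> in the duality map of \<open>v\<close>. Choosing \<open>y\<close> with displacement close to a large negative multiple
of \<open>v\<close>, and \<open>\<phi>\<close> attaining \<open>radial v (- y)\<close>, makes \<open>\<phi> (f (s v) - s v)\<close> very negative for some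
\<open>s\<close>. The functional depends on the wanted bound, but these quantities decrease in \<open>s\<close> and are
bounded above, so a geometrically weighted average of countably many such functionals serves all
bounds at once (\<open>dense_range_imp_radially_inward\<close>).

(ii): orbits of \<open>f + u\<close> stay in an approximate fixed point set, hence are bounded, and a bounded orbit
of a nonexpansive map yields an invariant closed bounded convex set.

(iii): suppose that the displacements of \<open>g = f + u\<close> have infimum \<open>d > 0\<close> in norm. The functionals
norming the resolvent points asymptotically satisfy \<open>\<phi> (g y - y) \<ge> d\<close> for every \<open>y\<close>. Testing this
at a \<open>y\<close> whose displacement is nearly minimal, uniform convexity of the dual shows that they converge
in norm. The limit attains its norm at some unit vector \<open>v\<close>, because a uniformly smooth space is
reflexive, and by smoothness it is the only element of the duality map of \<open>v\<close>. This contradicts (e)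
at \<open>v\<close>.

(iv): if \<open>f x + u = x\<close>, then monotonicity bounds the inner product of \<open>x\<close> with \<open>f y - y + u\<close> below,
independently of \<open>x\<close>. When \<open>f - id\<close> is onto, these vectors exhaust the space, and the uniform
boundedness principle bounds the set of fixed points.

(v): in finite dimension the fixed point property holds by compactness, so the implications
(a), (b), (c), (d), (e) form a chain and it remains to close it. Given an unbounded sequence of
approximate fixed points, a unit vector violating (e) is sought. For a smooth norm any limit direction
of the sequence works. For a polyhedral norm, a maximum of finitely many functionals, one keeps those
functionals that stay within bounded distance of the norm along the sequence and takes a vector in the
relative interior of the corresponding face.
\<close>

section \<open>Supporting functionals of sublinear functions\<close>

definition sublinear :: "('a::real_vector \<Rightarrow> real) \<Rightarrow> bool" where
  "sublinear p \<longleftrightarrow>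
    p 0 = 0 \<and> (\<forall>x y. p (x + y) \<le> p x + p y) \<and> (\<forall>c>0. \<forall>x. p (c *\<^sub>R x) = c * p x)"

lemma sublinearI:
  assumes "p 0 = 0" and "\<And>x y. p (x + y) \<le> p x + p y"
    and scale: "\<And>c x. c > 0 \<Longrightarrow> p (c *\<^sub>R x) \<le> c * p x"
  shows "sublinear p"
proof -
  have "c * p x \<le> p (c *\<^sub>R x)" if "c > 0" for c x
    using scale[of "inverse c" "c *\<^sub>R x"] that by (simp add: field_simps)
  then show ?thesis
    unfolding sublinear_def using assms by (auto intro!: antisym)
qed

lemma sublinear_neg_le:
  assumes "sublinear p"
  shows "- p (- x) \<le> p x"
proof -
  have "p (x + - x) \<le> p x + p (- x)"
    using assms unfolding sublinear_def by blast
  then show ?thesis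
    using assms unfolding sublinear_def by simp
qed

lemma sublinear_scaleR:
  assumes "sublinear p" "c \<ge> 0"
  shows "p (c *\<^sub>R x) = c * p x"
  using assms unfolding sublinear_def by (cases "c = 0") auto

lemma sublinear_odd_imp_linear:
  assumes p: "sublinear p" and odd: "\<And>x. p (- x) = - p x"
  shows "linear p"
proof (rule linearI)
  have le: "p (x + y) \<le> p x + p y" for x y
    using p unfolding sublinear_def by blast
  show "p (x + y) = p x + p y" for x y
    using le[of x y] le[of "x + y" "- y"] odd[of y] by simp
  show "p (c *\<^sub>R x) = c *\<^sub>R p x" for c x
  proof (cases "c \<ge> 0")
    case True
    then show ?thesis using sublinear_scaleR[OF p] by simp
  next
    case False
    then have "p ((- c) *\<^sub>R x) = (- c) * p x"
      by (intro sublinear_scaleR[OF p]) simp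
    then show ?thesis using odd[of "c *\<^sub>R x"] by simp
  qed
qed

text \<open>
Every sublinear \<open>p\<close> satisfies \<open>- p v \<le> p (- v)\<close>. Taking \<open>q x\<close> to be the infimum of
\<open>p (x + t v) - t p v\<close> over \<open>t \<ge> 0\<close> lowers the value at \<open>- v\<close> to this bound and keeps sublinearity. A minimal sublinear functional is therefore odd, hence linear,
and the same construction makes a linear minorant agree with \<open>p\<close> at \<open>v\<close>.
\<close>

lemma sublinear_tilt:
  assumes p: "sublinear p"
  obtains q where "sublinear q" "q \<le> p" "q (- v) = - p v"
proof -
  define q where "q x = (INF t\<in>{0::real..}. p (x + t *\<^sub>R v) - t * p v)" for x
  have add: "p (x + y) \<le> p x + p y" for x y
    using p unfolding sublinear_def by blast
  have lower: "- p (- x) \<le> p (x + t *\<^sub>R v) - t * p v" if "t \<ge> 0" for x t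
    using add[of "x + t *\<^sub>R v" "- x"] sublinear_scaleR[OF p that, of v] by simp
  have bdd: "bdd_below ((\<lambda>t. p (x + t *\<^sub>R v) - t * p v) ` {0..})" for x
    using lower[of _ x] by (intro bdd_belowI2[where m="- p (- x)"]) auto
  have q_le: "q x \<le> p (x + t *\<^sub>R v) - t * p v" if "t \<ge> 0" for x t
    unfolding q_def using that by (intro cINF_lower[OF bdd]) auto
  have q_ge: "m \<le> q x" if "\<And>t. t \<ge> 0 \<Longrightarrow> m \<le> p (x + t *\<^sub>R v) - t * p v" for m x
    unfolding q_def using that by (intro cINF_greatest) auto
  have q_add: "q (x + y) \<le> q x + q y" for x y
  proof -
    have "q (x + y) - (p (y + t *\<^sub>R v) - t * p v) \<le> p (x + s *\<^sub>R v) - s * p v"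
      if "s \<ge> 0" "t \<ge> 0" for s t
      using q_le[of "s + t" "x + y"] add[of "x + s *\<^sub>R v" "y + t *\<^sub>R v"] that
      by (simp add: algebra_simps)
    then have "q (x + y) - (p (y + t *\<^sub>R v) - t * p v) \<le> q x" if "t \<ge> 0" for t
      using that by (intro q_ge) auto
    then have "q (x + y) - q x \<le> q y"
      by (intro q_ge) (simp add: algebra_simps)
    then show ?thesis by simp
  qed
  have q_scale: "q (c *\<^sub>R x) \<le> c * q x" if c: "c > 0" for c x
  proof -
    have "q (c *\<^sub>R x) / c \<le> q x"
    proof (rule q_ge)
      fix t :: real assume "t \<ge> 0"
      then have "q (c *\<^sub>R x) \<le> p (c *\<^sub>R x + (c * t) *\<^sub>R v) - (c * t) * p v"
        using c by (intro q_le) simp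
      also have "c *\<^sub>R x + (c * t) *\<^sub>R v = c *\<^sub>R (x + t *\<^sub>R v)"
        by (simp add: algebra_simps)
      also have "p \<dots> = c * p (x + t *\<^sub>R v)"
        using sublinear_scaleR[OF p] c by simp
      finally show "q (c *\<^sub>R x) / c \<le> p (x + t *\<^sub>R v) - t * p v"
        using c by (simp add: field_simps)
    qed
    then show ?thesis using c by (simp add: field_simps)
  qed
  have p0: "p 0 = 0" using p unfolding sublinear_def by simp
  have "q 0 \<le> 0" using q_le[of 0 0] p0 by simp
  moreover have "0 \<le> q 0" using lower[of _ 0] p0 by (intro q_ge) simp
  ultimately have "sublinear q"
    using q_add q_scale by (intro sublinearI) auto
  moreover have "q \<le> p"
    using q_le[of 0] by (auto simp: le_fun_def)
  moreover have "q (- v) = - p v"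
    using q_le[of 1 "- v"] lower[of _ "- v"] p0 by (intro antisym q_ge) auto
  ultimately show thesis by (rule that)
qed

text \<open>
The pointwise infimum works: it is finite because every sublinear \<open>q \<le> p\<close> satisfies
\<open>- p (- x) \<le> q x\<close>, and subadditive because two members of a chain have a smaller one among them.
\<close>

lemma sublinear_chain_lower_bound:
  assumes ne: "C \<noteq> {}" and sub: "\<And>q. q \<in> C \<Longrightarrow> sublinear q"
    and dom: "\<And>q. q \<in> C \<Longrightarrow> q \<le> p"
    and chain: "\<And>q r. q \<in> C \<Longrightarrow> r \<in> C \<Longrightarrow> q \<le> r \<or> r \<le> q"
  obtains m where "sublinear m" "\<And>q. q \<in> C \<Longrightarrow> m \<le> q"
proof -
  define m where "m x = (INF q\<in>C. q x)" for x
  have "- p (- x) \<le> q x" if "q \<in> C" for q x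
    using sublinear_neg_le[OF sub[OF that], of x] le_funD[OF dom[OF that], of "- x"] by simp
  then have bdd: "bdd_below ((\<lambda>q. q x) ` C)" for x
    by (intro bdd_belowI2) auto
  have m_le: "m x \<le> q x" if "q \<in> C" for q x
    unfolding m_def using that by (intro cINF_lower[OF bdd])
  have m_ge: "a \<le> m x" if "\<And>q. q \<in> C \<Longrightarrow> a \<le> q x" for a x
    unfolding m_def using that ne by (intro cINF_greatest) auto
  have m_add: "m (x + y) \<le> m x + m y" for x y
  proof -
    have "m (x + y) \<le> q x + r y" if q: "q \<in> C" and r: "r \<in> C" for q r
    proof -
      obtain s where s: "s \<in> C" "s \<le> q" "s \<le> r"
        using chain[OF q r] q r by blast
      have "m (x + y) \<le> s (x + y)" using m_le s by blast
      also have "\<dots> \<le> s x + s y" using sub[OF s(1)] unfolding sublinear_def by blast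
      also have "\<dots> \<le> q x + r y" using s by (intro add_mono) (auto dest: le_funD)
      finally show ?thesis .
    qed
    then have "m (x + y) - r y \<le> m x" if "r \<in> C" for r
      using that by (intro m_ge) (simp add: algebra_simps)
    then have "m (x + y) - m x \<le> m y"
      by (intro m_ge) (simp add: algebra_simps)
    then show ?thesis by simp
  qed
  have m_scale: "m (c *\<^sub>R x) \<le> c * m x" if c: "c > 0" for c x
  proof -
    have "m (c *\<^sub>R x) / c \<le> m x"
      using m_le[of _ "c *\<^sub>R x"] sub c
      by (intro m_ge) (force simp: field_simps sublinear_def)
    then show ?thesis using c by (simp add: field_simps)
  qed
  have "q 0 = 0" if "q \<in> C" for q
    using sub[OF that] unfolding sublinear_def by blast
  then have "m 0 = 0"
    using m_le[of _ 0] m_ge[of 0 0] ne by fastforce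
  then have "sublinear m"
    using m_add m_scale by (intro sublinearI)
  then show thesis
    using that m_le by (auto simp: le_fun_def)
qed

text \<open>
The Hahn-Banach theorem in the form of supporting functionals: a minimal sublinear functional below
the tilt of \<open>p\<close> at \<open>v\<close>, which exists by Zorn's lemma, is linear.
\<close>

theorem linear_functional_below_sublinear:
  assumes p: "sublinear p"
  obtains g where "linear g" "\<And>x. g x \<le> p x" "g v = p v"
proof -
  obtain p0 where p0: "sublinear p0" "p0 \<le> p" "p0 (- v) = - p v"
    by (rule sublinear_tilt[OF p])
  define S where "S = {q. sublinear q \<and> q \<le> p0}"
  \<comment> \<open>A maximal element for the reversed order is a minimal functional.\<close>
  have "\<exists>m\<in>S. \<forall>a\<in>S. (\<lambda>x y. y \<le> x) m a \<longrightarrow> a = m"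
  proof (rule predicate_Zorn)
    show "partial_order_on S (relation_of (\<lambda>x y. y \<le> x) S)"
      by (rule partial_order_on_relation_ofI) auto
    fix C assume C: "C \<in> Chains (relation_of (\<lambda>x y. y \<le> x) S)"
    then have CS: "C \<subseteq> S" and chain: "\<And>q r. q \<in> C \<Longrightarrow> r \<in> C \<Longrightarrow> q \<le> r \<or> r \<le> q"
      unfolding Chains_def relation_of_def by auto
    show "\<exists>u\<in>S. \<forall>a\<in>C. u \<le> a"
    proof (cases "C = {}")
      case True
      then show ?thesis using p0 unfolding S_def by auto
    next
      case False
      have "\<And>q. q \<in> C \<Longrightarrow> sublinear q" "\<And>q. q \<in> C \<Longrightarrow> q \<le> p0"
        using CS unfolding S_def by auto
      then obtain m where m: "sublinear m" "\<And>q. q \<in> C \<Longrightarrow> m \<le> q"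
        using sublinear_chain_lower_bound[OF False _ _ chain] by metis
      have "m \<in> S"
        using m False CS unfolding S_def by (auto intro: order_trans)
      then show ?thesis using m by blast
    qed
  qed
  then obtain g where g: "sublinear g" "g \<le> p0"
    and minimal: "\<And>a. sublinear a \<Longrightarrow> a \<le> g \<Longrightarrow> a = g"
    unfolding S_def by (auto intro: order_trans)
  have odd: "g (- x) = - g x" for x
  proof -
    obtain q where "sublinear q" "q \<le> g" "q (- x) = - g x"
      by (rule sublinear_tilt[OF g(1)])
    then show ?thesis using minimal by metis
  qed
  have gp: "g x \<le> p x" for x
    using g(2) p0(2) by (auto simp: le_fun_def intro: order_trans)
  have "g v = p v"
    using le_funD[OF g(2), of "- v"] p0(3) odd[of v] gp[of v] by simp
  then show thesis
    using that[of g] sublinear_odd_imp_linear[OF g(1) odd] gp by blast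
qed

lemma blinfun_below_sublinear:
  fixes p :: "'a::real_normed_vector \<Rightarrow> real"
  assumes p: "sublinear p" and bound: "\<And>x. p x \<le> K * norm x"
  obtains \<phi> :: "'a \<Rightarrow>\<^sub>L real" where "\<And>x. \<phi> x \<le> p x" "\<phi> v = p v"
proof -
  obtain g where g: "linear g" "\<And>x. g x \<le> p x" "g v = p v"
    using linear_functional_below_sublinear[OF p, where v = v] by blast
  have "\<bar>g x\<bar> \<le> norm x * K" for x
    using g(2)[of x] g(2)[of "- x"] bound[of x] bound[of "- x"] linear_neg[OF g(1), of x]
    by (simp add: abs_le_iff mult.commute)
  then have "bounded_linear g"
    using g(1) by (intro bounded_linear.intro bounded_linear_axioms.intro) auto
  then show thesis
    using that[of "Blinfun g"] g by (simp add: bounded_linear_Blinfun_apply)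
qed

lemma norm_blinfun_le_oneI:
  fixes \<phi> :: "'a::real_normed_vector \<Rightarrow>\<^sub>L real"
  assumes "\<And>x. \<phi> x \<le> norm x"
  shows "norm \<phi> \<le> 1"
  using assms[of "- _"] assms
  by (intro norm_blinfun_bound) (auto simp: abs_le_iff blinfun.minus_right)

lemma blinfun_apply_le:
  fixes \<phi> :: "'a::real_normed_vector \<Rightarrow>\<^sub>L real"
  assumes "norm \<phi> \<le> 1"
  shows "\<phi> x \<le> norm x" and "- norm x \<le> \<phi> x"
proof -
  have "\<bar>\<phi> x\<bar> \<le> norm \<phi> * norm x" using norm_blinfun[of \<phi> x] by simp
  also have "\<dots> \<le> 1 * norm x" using assms by (intro mult_right_mono) auto
  finally show "\<phi> x \<le> norm x" "- norm x \<le> \<phi> x" by auto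
qed

lemma norming_functional:
  fixes x :: "'a::real_normed_vector"
  obtains \<phi> :: "'a \<Rightarrow>\<^sub>L real" where "norm \<phi> \<le> 1" "\<phi> x = norm x"
proof -
  have "sublinear (norm :: 'a \<Rightarrow> real)"
    by (intro sublinearI) (auto intro: norm_triangle_ineq)
  then obtain \<phi> :: "'a \<Rightarrow>\<^sub>L real" where "\<And>y. \<phi> y \<le> norm y" "\<phi> x = norm x"
    using blinfun_below_sublinear[of norm 1] by auto
  then show thesis using that norm_blinfun_le_oneI by blast
qed

lemma duality_map_unit_iff:
  fixes \<phi> :: "'a::real_normed_vector \<Rightarrow>\<^sub>L real"
  assumes x: "norm x = 1"
  shows "\<phi> \<in> duality_map x \<longleftrightarrow> norm \<phi> \<le> 1 \<and> \<phi> x = 1"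
  using blinfun_apply_le(1)[of \<phi> x] norm_blinfun[of \<phi> x] x
  unfolding duality_map_def by auto

section \<open>The derivative of the norm along a ray\<close>

text \<open>
The one-sided derivative of the norm at the unit vector \<open>v\<close> in direction \<open>y\<close>. The difference is
nonincreasing in \<open>s\<close>, so the infimum is its limit at infinity.
\<close>

definition radial :: "'a::real_normed_vector \<Rightarrow> 'a \<Rightarrow> real" where
  "radial v y = (INF s\<in>{0..}. norm (s *\<^sub>R v + y) - s)"

context
  fixes v :: "'a::real_normed_vector"
  assumes v: "norm v = 1"
begin

lemma radial_bdd: "bdd_below ((\<lambda>s. norm (s *\<^sub>R v + y) - s) ` {0..})"
proof (rule bdd_belowI2)
  fix s :: real assume "s \<in> {0..}"
  then show "- norm y \<le> norm (s *\<^sub>R v + y) - s"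
    using norm_triangle_ineq4[of "s *\<^sub>R v + y" y] v by simp
qed

lemma radial_le: "s \<ge> 0 \<Longrightarrow> radial v y \<le> norm (s *\<^sub>R v + y) - s"
  unfolding radial_def by (intro cINF_lower[OF radial_bdd]) auto

lemma radial_ge: "(\<And>s. s \<ge> 0 \<Longrightarrow> m \<le> norm (s *\<^sub>R v + y) - s) \<Longrightarrow> m \<le> radial v y"
  unfolding radial_def by (intro cINF_greatest) auto

lemma radial_approx:
  assumes "\<epsilon> > 0"
  obtains s where "s \<ge> 0" "norm (s *\<^sub>R v + y) - s < radial v y + \<epsilon>"
  using radial_ge[of "radial v y + \<epsilon>" y] assms by (metis add_le_same_cancel1 linorder_not_le)

lemma sublinear_radial: "sublinear (radial v)"
proof (rule sublinearI)
  show "radial v 0 = 0"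
    using radial_le[of 0 0] v by (intro antisym radial_ge) auto
  show "radial v (x + y) \<le> radial v x + radial v y" for x y
  proof -
    have "radial v (x + y) - (norm (t *\<^sub>R v + y) - t) \<le> norm (s *\<^sub>R v + x) - s"
      if "s \<ge> 0" "t \<ge> 0" for s t
      using radial_le[of "s + t" "x + y"] that
        norm_triangle_ineq[of "s *\<^sub>R v + x" "t *\<^sub>R v + y"]
      by (simp add: algebra_simps)
    then have "radial v (x + y) - (norm (t *\<^sub>R v + y) - t) \<le> radial v x" if "t \<ge> 0" for t
      using that by (intro radial_ge) auto
    then have "radial v (x + y) - radial v x \<le> radial v y"
      by (intro radial_ge) (simp add: algebra_simps)
    then show ?thesis by simp
  qed
  show "radial v (c *\<^sub>R x) \<le> c * radial v x" if c: "c > 0" for c x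
  proof -
    have "radial v (c *\<^sub>R x) / c \<le> radial v x"
    proof (rule radial_ge)
      fix s :: real assume "s \<ge> 0"
      then have "radial v (c *\<^sub>R x) \<le> norm ((c * s) *\<^sub>R v + c *\<^sub>R x) - c * s"
        using c by (intro radial_le) simp
      also have "(c * s) *\<^sub>R v + c *\<^sub>R x = c *\<^sub>R (s *\<^sub>R v + x)"
        by (simp add: algebra_simps)
      also have "norm \<dots> = c * norm (s *\<^sub>R v + x)"
        using c by simp
      finally show "radial v (c *\<^sub>R x) / c \<le> norm (s *\<^sub>R v + x) - s"
        using c by (simp add: field_simps)
    qed
    then show ?thesis using c by (simp add: field_simps)
  qed
qed

text \<open>
The Hahn-Banach functional below \<open>radial v\<close> is bounded by the norm, and \<open>radial v (- v) \<le> - 1\<close>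
forces its value at \<open>v\<close> to be one.
\<close>

lemma radial_attained:
  obtains \<phi> where "\<phi> \<in> duality_map v" "blinfun_apply \<phi> y = radial v y"
proof -
  have le_norm: "radial v x \<le> norm x" for x
    using radial_le[of 0 x] by simp
  then obtain \<phi> :: "'a \<Rightarrow>\<^sub>L real" where \<phi>: "\<And>x. \<phi> x \<le> radial v x" "\<phi> y = radial v y"
    using blinfun_below_sublinear[OF sublinear_radial, of 1] by auto
  have "\<phi> (- v) \<le> - 1"
    using \<phi>(1)[of "- v"] radial_le[of 1 "- v"] by simp
  then have "\<phi> v \<ge> 1" by (simp add: blinfun.minus_right)
  moreover have "\<phi> x \<le> norm x" for x
    using \<phi>(1)[of x] le_norm[of x] by simp
  ultimately have "\<phi> \<in> duality_map v"
    using v by (metis antisym duality_map_unit_iff norm_blinfun_le_oneI)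
  then show thesis using that \<phi>(2) by blast
qed

end

section \<open>Resolvents and density of the displacement range\<close>

lemma nonexpansiveD: "nonexpansive_on UNIV f \<Longrightarrow> norm (f x - f y) \<le> norm (x - y)"
  unfolding nonexpansive_on_def by auto

lemma nonexpansive_translate:
  "nonexpansive_on UNIV f \<Longrightarrow> nonexpansive_on UNIV (\<lambda>x. f x + u)"
  unfolding nonexpansive_on_def by auto

text \<open>
Such an \<open>x\<close> is the fixed point of the contraction \<open>x \<mapsto> g x / (1 + s)\<close>.
\<close>

lemma resolvent_exists:
  fixes g :: "'a::banach \<Rightarrow> 'a"
  assumes g: "nonexpansive_on UNIV g" and s: "s > 0"
  obtains x where "g x - x = s *\<^sub>R x"
proof -
  define c where "c = inverse (1 + s)"
  have c: "0 \<le> c" "c < 1" using s by (auto simp: c_def field_simps)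
  have "dist (c *\<^sub>R g x) (c *\<^sub>R g y) \<le> c * dist x y" for x y
    using nonexpansiveD[OF g, of x y] c
    by (simp add: dist_norm mult_left_mono flip: scaleR_diff_right)
  then obtain x where "c *\<^sub>R g x = x"
    using banach_fix_type[OF c, of "\<lambda>x. c *\<^sub>R g x"] by auto
  then have "(1 + s) *\<^sub>R x = (1 + s) *\<^sub>R c *\<^sub>R g x" by simp
  also have "\<dots> = g x" using s by (simp add: c_def)
  finally have "g x - x = s *\<^sub>R x" by (simp add: algebra_simps)
  then show thesis by (rule that)
qed

text \<open>
This keeps the displacement at the resolvent points bounded as \<open>s\<close> tends to \<open>0\<close>.
\<close>

lemma resolvent_bound:
  assumes g: "nonexpansive_on UNIV g" and "s > 0" and x: "g x - x = s *\<^sub>R x"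
  shows "s * norm x \<le> norm (g 0)"
proof -
  have "g x = (1 + s) *\<^sub>R x" using x by (simp add: algebra_simps)
  then have "(1 + s) * norm x = norm (g x)" using \<open>s > 0\<close> by simp
  also have "\<dots> \<le> norm (g x - g 0) + norm (g 0)"
    using norm_triangle_ineq[of "g x - g 0" "g 0"] by simp
  also have "\<dots> \<le> norm x + norm (g 0)"
    using nonexpansiveD[OF g, of x 0] by simp
  finally show ?thesis by (simp add: algebra_simps)
qed

lemma bounded_approx_translate:
  assumes "approx_fixed_points_bounded f"
  shows "approx_fixed_points_bounded (\<lambda>x. f x + u)"
  unfolding approx_fixed_points_bounded_def
proof (intro allI impI)
  fix \<delta> :: real assume "\<delta> > 0"
  have "norm (f x - x) \<le> \<delta> + norm u" if "norm (f x + u - x) \<le> \<delta>" for x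
    using norm_triangle_ineq4[of "f x + u - x" u] that by (simp add: algebra_simps)
  then have "approx_fixed_points \<delta> (\<lambda>x. f x + u) \<subseteq> approx_fixed_points (\<delta> + norm u) f"
    unfolding approx_fixed_points_def by auto
  moreover have "bounded (approx_fixed_points (\<delta> + norm u) f)"
    using assms \<open>\<delta> > 0\<close> norm_ge_zero[of u] unfolding approx_fixed_points_bounded_def
    by (meson add_pos_nonneg)
  ultimately show "bounded (approx_fixed_points \<delta> (\<lambda>x. f x + u))"
    by (rule bounded_subset[rotated])
qed

lemma displacement_dense_range_iff:
  fixes f :: "'a::real_normed_vector \<Rightarrow> 'a"
  shows "displacement_dense_range f \<longleftrightarrow> (\<forall>u. \<forall>\<epsilon>>0. \<exists>x. norm (f x + u - x) < \<epsilon>)"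
proof -
  have "displacement_dense_range f \<longleftrightarrow> (\<forall>u. \<forall>\<epsilon>>0. \<exists>x. norm (f x - x - u) < \<epsilon>)"
    unfolding displacement_dense_range_def
    by (auto simp: set_eq_iff closure_approachable dist_norm)
  also have "\<dots> \<longleftrightarrow> (\<forall>u. \<forall>\<epsilon>>0. \<exists>x. norm (f x - x - (- u)) < \<epsilon>)"
    by (metis minus_minus)
  finally show ?thesis by (simp add: algebra_simps)
qed

lemma bounded_approx_imp_dense_range:
  fixes f :: "'a::banach \<Rightarrow> 'a"
  assumes f: "nonexpansive_on UNIV f" and bdd: "approx_fixed_points_bounded f"
  shows "displacement_dense_range f"
  unfolding displacement_dense_range_iff
proof (intro allI impI)
  fix u and \<epsilon> :: real assume \<epsilon>: "\<epsilon> > 0"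
  define g where "g x = f x + u" for x
  have g: "nonexpansive_on UNIV g"
    unfolding g_def by (rule nonexpansive_translate[OF f])
  have "bounded (approx_fixed_points (norm (g 0) + 1) g)"
    using bounded_approx_translate[OF bdd, of u]
    unfolding approx_fixed_points_bounded_def g_def by (meson add_nonneg_pos norm_ge_zero zero_less_one)
  then obtain b where b: "b > 0" "\<And>x. norm (g x - x) \<le> norm (g 0) + 1 \<Longrightarrow> norm x \<le> b"
    unfolding bounded_pos approx_fixed_points_def by auto
  define s where "s = \<epsilon> / (2 * b)"
  have s: "s > 0" using \<epsilon> b by (simp add: s_def)
  obtain x where x: "g x - x = s *\<^sub>R x" by (rule resolvent_exists[OF g s])
  have "norm (g x - x) \<le> norm (g 0) + 1"
    using resolvent_bound[OF g s x] s x by simp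
  then have "norm x \<le> b" by (rule b)
  then have "s * norm x \<le> s * b" using s by simp
  also have "s * b < \<epsilon>" using \<epsilon> b by (simp add: s_def)
  finally have "norm (g x - x) < \<epsilon>" using s x by simp
  then show "\<exists>x. norm (f x + u - x) < \<epsilon>" unfolding g_def by blast
qed

lemma fixed_points_imp_displacement_onto:
  assumes "translates_have_bounded_fixed_points f"
  shows "displacement_onto f"
proof -
  have "\<exists>x. y = f x - x" for y
  proof -
    obtain x where "f x + - y = x"
      using assms unfolding translates_have_bounded_fixed_points_def by blast
    then show ?thesis by (metis add.commute add_diff_cancel_left' diff_add_cancel uminus_add_conv_diff)
  qed
  then show ?thesis unfolding displacement_onto_def by (auto simp: surj_def)
qed

lemma displacement_onto_imp_dense_range: "displacement_onto f \<Longrightarrow> displacement_dense_range f"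
  unfolding displacement_onto_def displacement_dense_range_def by simp

section \<open>Displacement along rays\<close>

lemma radial_displacement_antimono:
  fixes f :: "'a::real_normed_vector \<Rightarrow> 'a" and \<phi> :: "'a \<Rightarrow>\<^sub>L real"
  assumes f: "nonexpansive_on UNIV f" and v: "norm v = 1" and \<phi>: "\<phi> \<in> duality_map v"
    and "s \<le> t"
  shows "\<phi> (f (t *\<^sub>R v) - t *\<^sub>R v) \<le> \<phi> (f (s *\<^sub>R v) - s *\<^sub>R v)"
proof -
  have p: "norm \<phi> \<le> 1" "\<phi> v = 1" using \<phi> duality_map_unit_iff[OF v] by auto
  have "\<phi> (f (t *\<^sub>R v) - f (s *\<^sub>R v)) \<le> norm (f (t *\<^sub>R v) - f (s *\<^sub>R v))"
    by (rule blinfun_apply_le(1)[OF p(1)])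
  also have "\<dots> \<le> norm (t *\<^sub>R v - s *\<^sub>R v)" by (rule nonexpansiveD[OF f])
  also have "\<dots> = t - s" using v \<open>s \<le> t\<close> by (simp flip: scaleR_diff_left)
  finally show ?thesis using p(2) by (simp add: blinfun.diff_right blinfun.scaleR_right)
qed

text \<open>
Because the values decrease along the ray, divergence to minus infinity amounts to being unbounded
below.
\<close>

lemma displacement_radially_inward_iff:
  fixes f :: "'a::real_normed_vector \<Rightarrow> 'a"
  assumes f: "nonexpansive_on UNIV f"
  shows "displacement_radially_inward f \<longleftrightarrow>
    (\<forall>v. norm v = 1 \<longrightarrow>
      (\<exists>\<phi>\<in>duality_map v. \<forall>M. \<exists>t\<ge>0. blinfun_apply \<phi> (f (t *\<^sub>R v) - t *\<^sub>R v) \<le> M))"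
proof -
  have "filterlim (\<lambda>t. blinfun_apply \<phi> (f (t *\<^sub>R v) - t *\<^sub>R v)) at_bot at_top \<longleftrightarrow>
      (\<forall>M. \<exists>t\<ge>0. blinfun_apply \<phi> (f (t *\<^sub>R v) - t *\<^sub>R v) \<le> M)"
    if v: "norm v = 1" and \<phi>: "\<phi> \<in> duality_map v" for v \<phi>
  proof
    assume *: "filterlim (\<lambda>t. blinfun_apply \<phi> (f (t *\<^sub>R v) - t *\<^sub>R v)) at_bot at_top"
    show "\<forall>M. \<exists>t\<ge>0. blinfun_apply \<phi> (f (t *\<^sub>R v) - t *\<^sub>R v) \<le> M"
    proof
      fix M
      have "\<forall>\<^sub>F t in at_top. blinfun_apply \<phi> (f (t *\<^sub>R v) - t *\<^sub>R v) \<le> M"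
        using * unfolding filterlim_at_bot by blast
      then obtain T where "\<And>t. t \<ge> T \<Longrightarrow> blinfun_apply \<phi> (f (t *\<^sub>R v) - t *\<^sub>R v) \<le> M"
        unfolding eventually_at_top_linorder by blast
      then show "\<exists>t\<ge>0. blinfun_apply \<phi> (f (t *\<^sub>R v) - t *\<^sub>R v) \<le> M"
        by (intro exI[of _ "max T 0"]) auto
    qed
  next
    assume *: "\<forall>M. \<exists>t\<ge>0. blinfun_apply \<phi> (f (t *\<^sub>R v) - t *\<^sub>R v) \<le> M"
    show "filterlim (\<lambda>t. blinfun_apply \<phi> (f (t *\<^sub>R v) - t *\<^sub>R v)) at_bot at_top"
      unfolding filterlim_at_bot eventually_at_top_linorder
      using * radial_displacement_antimono[OF f v \<phi>] by (meson order_trans)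
  qed
  then show ?thesis
    unfolding displacement_radially_inward_def by (intro iff_allI imp_cong bex_cong refl)
qed

text \<open>
Condition (e) up to a prescribed level. For any \<open>\<phi>\<close> in the duality map of \<open>v\<close>,
\<open>\<phi> (f (s v) - f y) \<le> \<parallel>s v - y\<parallel>\<close>, and the right-hand side is approximately \<open>s + radial v (- y)\<close>. A
functional attaining \<open>radial v (- y)\<close> thus satisfies
\<open>\<phi> (f (s v) - s v) \<le> \<phi> (f y - y)\<close> up to a small error, and density of the range makes the right-hand
side as negative as desired.
\<close>

lemma dense_range_imp_functional_below:
  fixes f :: "'a::real_normed_vector \<Rightarrow> 'a"
  assumes f: "nonexpansive_on UNIV f" and dense: "displacement_dense_range f"
    and v: "norm v = 1"
  obtains \<phi> s where "\<phi> \<in> duality_map v" "s \<ge> 0"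
    "blinfun_apply \<phi> (f (s *\<^sub>R v) - s *\<^sub>R v) \<le> - M"
proof -
  \<comment> \<open>The margin \<open>2\<close> pays one unit for the approximation of \<open>y\<close> and one for that of \<open>radial\<close>.\<close>
  obtain y where y: "norm (f y + (M + 2) *\<^sub>R v - y) < 1"
    using dense unfolding displacement_dense_range_iff by (metis zero_less_one)
  obtain \<phi> :: "'a \<Rightarrow>\<^sub>L real" where \<phi>: "\<phi> \<in> duality_map v" and att: "\<phi> (- y) = radial v (- y)"
    by (rule radial_attained[OF v])
  have p: "norm \<phi> \<le> 1" "\<phi> v = 1" using \<phi> duality_map_unit_iff[OF v] by auto
  obtain s where s: "s \<ge> 0" "norm (s *\<^sub>R v + - y) - s < radial v (- y) + 1"
    using radial_approx[OF v zero_less_one] by blast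
  have "\<phi> (f (s *\<^sub>R v) - f y) \<le> norm (f (s *\<^sub>R v) - f y)"
    by (rule blinfun_apply_le(1)[OF p(1)])
  also have "\<dots> \<le> norm (s *\<^sub>R v - y)" by (rule nonexpansiveD[OF f])
  also have "\<dots> < s - \<phi> y + 1" using s att by (simp add: blinfun.minus_right)
  finally have "\<phi> (f (s *\<^sub>R v) - s *\<^sub>R v) < \<phi> (f y - y) + 1"
    using p(2) by (simp add: blinfun.diff_right blinfun.scaleR_right)
  moreover have "\<phi> (f y + (M + 2) *\<^sub>R v - y) < 1"
    using blinfun_apply_le(1)[OF p(1)] y by (rule le_less_trans)
  then have "\<phi> (f y - y) < - M - 1"
    using p(2) by (simp add: blinfun.diff_right blinfun.add_right blinfun.scaleR_right)
  ultimately show thesis using that[OF \<phi> s(1)] by simp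
qed

text \<open>
The duality map of a unit vector is closed under countable convex combinations.
\<close>

lemma duality_map_geometric_mean:
  fixes z :: "nat \<Rightarrow> 'a::real_normed_vector \<Rightarrow>\<^sub>L real"
  assumes v: "norm v = 1" and z: "\<And>n. z n \<in> duality_map v"
  obtains \<phi> where "\<phi> \<in> duality_map v"
    "\<forall>y. (\<lambda>n. (1/2) ^ Suc n * blinfun_apply (z n) y) sums blinfun_apply \<phi> y"
proof -
  have zn: "norm (z n) \<le> 1" "z n v = 1" for n
    using z duality_map_unit_iff[OF v] by auto
  define w where "w n = ((1/2) ^ Suc n :: real) *\<^sub>R z n" for n
  have half: "(\<lambda>n. (1/2) ^ Suc n :: real) sums 1"
    by (rule power_half_series)
  have w: "norm (w n) \<le> (1/2) ^ Suc n" for n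
    unfolding w_def using zn(1)[of n] by (simp add: mult_left_le)
  then have "summable (\<lambda>n. norm (w n))"
    by (intro summable_comparison_test[OF _ sums_summable[OF half]]) auto
  then have sm: "summable w" by (rule summable_norm_cancel)
  define \<phi> where "\<phi> = suminf w"
  have "w sums \<phi>" unfolding \<phi>_def by (rule summable_sums[OF sm])
  then have ap: "(\<lambda>n. w n y) sums \<phi> y" for y
    by (rule bounded_linear.sums[OF blinfun.bounded_linear_left])
  then have *: "(\<lambda>n. (1/2) ^ Suc n * z n y) sums \<phi> y" for y
    by (simp add: w_def blinfun.scaleR_left)
  have "\<phi> v = 1"
    using *[of v] half sums_unique2 by (simp add: zn(2)) blast
  moreover have "norm \<phi> \<le> 1"
  proof (rule norm_blinfun_le_oneI)
    fix x
    have "(1/2) ^ Suc n * z n x \<le> (1/2) ^ Suc n * norm x" for n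
      using blinfun_apply_le(1)[OF zn(1)] by (intro mult_left_mono) auto
    then have "\<phi> x \<le> 1 * norm x"
      using sums_le[OF _ *[of x] sums_mult2[OF half]] by blast
    then show "\<phi> x \<le> norm x" by simp
  qed
  ultimately have "\<phi> \<in> duality_map v" using duality_map_unit_iff[OF v] by blast
  then show thesis using that * by blast
qed

text \<open>
The functionals \<open>z n\<close> are chosen so negative that the weight \<open>2 ^ -(n + 1)\<close> of \<open>z n\<close> in the mean still
leaves the level \<open>- n\<close>; the remaining terms cannot compensate since all values on the ray are at most
\<open>\<parallel>f 0\<parallel>\<close>.
\<close>

lemma dense_range_imp_radially_inward:
  fixes f :: "'a::real_normed_vector \<Rightarrow> 'a"
  assumes f: "nonexpansive_on UNIV f" and dense: "displacement_dense_range f"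
  shows "displacement_radially_inward f"
  unfolding displacement_radially_inward_iff[OF f]
proof (intro allI impI)
  fix v :: 'a assume v: "norm v = 1"
  have "\<exists>\<phi> s. \<phi> \<in> duality_map v \<and> s \<ge> 0 \<and>
      blinfun_apply \<phi> (f (s *\<^sub>R v) - s *\<^sub>R v) \<le> - (2 ^ Suc n * real n)" for n
    using dense_range_imp_functional_below[OF f dense v] by blast
  then obtain z s where z: "\<And>n. z n \<in> duality_map v" and s: "\<And>n. s n \<ge> 0"
    and below: "\<And>n. blinfun_apply (z n) (f (s n *\<^sub>R v) - s n *\<^sub>R v) \<le> - (2 ^ Suc n * real n)"
    by metis
  obtain \<phi> :: "'a \<Rightarrow>\<^sub>L real" where \<phi>: "\<phi> \<in> duality_map v"
    and sums: "\<forall>y. (\<lambda>n. (1/2) ^ Suc n * blinfun_apply (z n) y) sums \<phi> y"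
    using duality_map_geometric_mean[of v z, OF v z] by blast
  define B where "B = norm (f 0)"
  have *: "\<phi> (f (s n *\<^sub>R v) - s n *\<^sub>R v) \<le> B - real n" for n
  proof -
    define y where "y = f (s n *\<^sub>R v) - s n *\<^sub>R v"
    have upper: "blinfun_apply (z k) y \<le> B" for k
    proof -
      have "norm (z k) \<le> 1" using z duality_map_unit_iff[OF v] by auto
      then have "blinfun_apply (z k) (f 0) \<le> B"
        unfolding B_def by (rule blinfun_apply_le(1))
      then show ?thesis
        using radial_displacement_antimono[OF f v z s, of k n] by (simp add: y_def)
    qed
    have half: "(\<lambda>k. (1/2) ^ Suc k * B) sums (1 * B)"
      by (intro sums_mult2 power_half_series)
    have "(\<lambda>k. (1/2) ^ Suc k * B - (1/2) ^ Suc k * blinfun_apply (z k) y) sums (1 * B - \<phi> y)"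
      by (intro sums_diff half sums[rule_format])
    then have gap: "(\<lambda>k. (1/2) ^ Suc k * (B - blinfun_apply (z k) y)) sums (B - \<phi> y)"
      by (simp add: right_diff_distrib)
    have "real n \<le> (1/2) ^ Suc n * (B - blinfun_apply (z n) y)"
    proof -
      have "real n = (1/2) ^ Suc n * (2 ^ Suc n * real n)"
        by (simp add: power_one_over)
      also have "\<dots> \<le> (1/2) ^ Suc n * (B - blinfun_apply (z n) y)"
        using below[of n] norm_ge_zero[of "f 0"]
        unfolding y_def B_def by (intro mult_left_mono) (linarith, simp)
      finally show ?thesis .
    qed
    also have "\<dots> \<le> B - \<phi> y"
      using sum_le_suminf[OF sums_summable[OF gap], of "{n}"] sums_unique[OF gap] upper by simp
    finally show ?thesis by (simp add: y_def)
  qed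
  have "\<exists>t\<ge>0. \<phi> (f (t *\<^sub>R v) - t *\<^sub>R v) \<le> M" for M
  proof -
    obtain n where "B - M < real n" using reals_Archimedean2 by blast
    then have "\<phi> (f (s n *\<^sub>R v) - s n *\<^sub>R v) \<le> M"
      using * [of n] by simp
    then show ?thesis using s by blast
  qed
  then show "\<exists>\<phi>\<in>duality_map v. \<forall>M. \<exists>t\<ge>0. blinfun_apply \<phi> (f (t *\<^sub>R v) - t *\<^sub>R v) \<le> M"
    using \<phi> by blast
qed

section \<open>Fixed points from bounded orbits\<close>

text \<open>
The points whose distance to all late points of the orbit is at most the diameter of the orbit form a nonempty bounded
convex set that \<open>g\<close> maps into itself; its closure is a domain for the fixed point property.
\<close>

lemma bounded_orbit_imp_fixed_point:
  fixes g :: "'a::real_normed_vector \<Rightarrow> 'a"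
  assumes fpp: "fixed_point_property TYPE('a)" and g: "nonexpansive_on UNIV g"
    and bdd: "bounded (range (\<lambda>n. (g ^^ n) a))"
  obtains x where "g x = x"
proof -
  define r where "r = diameter (range (\<lambda>n. (g ^^ n) a))"
  define D where "D n = (\<Inter>k\<in>{n..}. cball ((g ^^ k) a) r)" for n
  define C where "C = closure (\<Union>n. D n)"
  have Dmono: "D m \<subseteq> D n" if "m \<le> n" for m n
    using that unfolding D_def by (intro INF_superset_mono) auto
  have Dg: "g ` D n \<subseteq> D (Suc n)" for n
  proof -
    have "dist ((g ^^ k) a) (g x) \<le> r"
      if x: "\<forall>k\<ge>n. dist ((g ^^ k) a) x \<le> r" and k: "Suc n \<le> k" for x k
    proof -
      from k obtain j where j: "k = Suc j" "n \<le> j" by (cases k) auto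
      have "dist ((g ^^ k) a) (g x) \<le> dist ((g ^^ j) a) x"
        using nonexpansiveD[OF g] by (simp add: j dist_norm)
      also have "\<dots> \<le> r" using x j by simp
      finally show "dist ((g ^^ k) a) (g x) \<le> r" .
    qed
    then show ?thesis unfolding D_def by auto
  qed
  have "dist ((g ^^ k) a) ((g ^^ 0) a) \<le> r" for k
    unfolding r_def by (intro diameter_bounded_bound[OF bdd]) (rule rangeI)+
  then have "a \<in> D 0" unfolding D_def by simp
  then have ne: "C \<noteq> {}" unfolding C_def by auto
  have "convex (\<Union>n. D n)"
    unfolding convex_alt
  proof (intro ballI allI impI)
    fix x y and u :: real
    assume "x \<in> (\<Union>n. D n)" "y \<in> (\<Union>n. D n)" and u: "0 \<le> u \<and> u \<le> 1"
    then obtain m n where *: "x \<in> D m" "y \<in> D n" by blast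
    have "convex (D (max m n))"
      unfolding D_def by (intro convex_INT convex_cball)
    moreover have "x \<in> D (max m n)" "y \<in> D (max m n)"
      using * Dmono[of m "max m n"] Dmono[of n "max m n"] by auto
    ultimately have "(1 - u) *\<^sub>R x + u *\<^sub>R y \<in> D (max m n)"
      using u unfolding convex_alt by blast
    then show "(1 - u) *\<^sub>R x + u *\<^sub>R y \<in> (\<Union>n. D n)" by blast
  qed
  then have convex: "convex C" unfolding C_def by (rule convex_closure)
  obtain b where b: "\<And>n. norm ((g ^^ n) a) \<le> b"
    using bdd unfolding bounded_iff by auto
  have "norm x \<le> b + r" if "x \<in> D n" for x n
  proof -
    have "dist ((g ^^ n) a) x \<le> r" using that unfolding D_def by auto
    then show ?thesis
      using b[of n] norm_triangle_ineq4[of "(g ^^ n) a" "(g ^^ n) a - x"] by (simp add: dist_norm)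
  qed
  then have "bounded (\<Union>n. D n)" unfolding bounded_iff by blast
  then have bounded: "bounded C" unfolding C_def by (rule bounded_closure)
  have cont: "continuous_on UNIV g"
    unfolding continuous_on_iff dist_norm
    by (meson nonexpansiveD[OF g] order_le_less_trans)
  have "g x \<in> D (Suc n)" if "x \<in> D n" for x n
    using Dg[of n] that by (rule subsetD[OF _ imageI])
  then have "g ` (\<Union>n. D n) \<subseteq> (\<Union>n. D n)" by auto
  then have "g ` (\<Union>n. D n) \<subseteq> C"
    unfolding C_def using closure_subset by (rule subset_trans)
  then have inv: "g ` C \<subseteq> C"
    unfolding C_def by (intro image_closure_subset continuous_on_subset[OF cont]) auto
  have "nonexpansive_on C g" using g unfolding nonexpansive_on_def by blast
  then obtain x where "g x = x"
    using fpp[unfolded fixed_point_property_def, rule_format, of C g] ne bounded convex inv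
    by (auto simp: C_def)
  then show thesis by (rule that)
qed

lemma bounded_approx_imp_fixed_points:
  fixes f :: "'a::real_normed_vector \<Rightarrow> 'a"
  assumes fpp: "fixed_point_property TYPE('a)" and f: "nonexpansive_on UNIV f"
    and bdd: "approx_fixed_points_bounded f"
  shows "translates_have_bounded_fixed_points f"
  unfolding translates_have_bounded_fixed_points_def
proof
  fix u
  define g where "g x = f x + u" for x
  define \<delta> where "\<delta> = norm (g 0) + 1"
  have g: "nonexpansive_on UNIV g"
    unfolding g_def by (rule nonexpansive_translate[OF f])
  have "\<delta> > 0" unfolding \<delta>_def by (simp add: add_nonneg_pos)
  then have F: "bounded {x. norm (g x - x) \<le> \<delta>}"
    using bounded_approx_translate[OF bdd, of u]
    unfolding approx_fixed_points_bounded_def approx_fixed_points_def g_def by blast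
  have "norm (g ((g ^^ n) 0) - (g ^^ n) 0) \<le> \<delta>" for n
  proof (induction n)
    case (Suc n)
    then show ?case using nonexpansiveD[OF g, of "g ((g ^^ n) 0)" "(g ^^ n) 0"] by simp
  qed (simp add: \<delta>_def)
  then have "bounded (range (\<lambda>n. (g ^^ n) 0))"
    by (intro bounded_subset[OF F]) auto
  then obtain x where "g x = x"
    by (rule bounded_orbit_imp_fixed_point[OF fpp g])
  moreover have "bounded {x. g x = x}"
    using \<open>\<delta> > 0\<close> by (intro bounded_subset[OF F]) auto
  ultimately show "{x. f x + u = x} \<noteq> {} \<and> bounded {x. f x + u = x}"
    unfolding g_def by blast
qed

section \<open>Uniformly smooth spaces are reflexive\<close>

lemma blinfun_exceeds:
  fixes \<phi> :: "'a::real_normed_vector \<Rightarrow>\<^sub>L real"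
  assumes "0 \<le> \<theta>" "\<theta> < norm \<phi>"
  obtains x where "norm x = 1" "\<theta> < \<phi> x"
proof (rule ccontr)
  note exceeds = that
  assume "\<not> thesis"
  then have *: "\<phi> x \<le> \<theta>" if "norm x = 1" for x
    using exceeds[OF that] by (meson not_le)
  have "\<phi> x \<le> \<theta> * norm x" for x
  proof (cases "x = 0")
    case False
    then show ?thesis
      using *[of "inverse (norm x) *\<^sub>R x"] by (simp add: blinfun.scaleR_right field_simps)
  qed (simp add: blinfun.zero_right)
  from this this[of "- _"] have "norm \<phi> \<le> \<theta>"
    using \<open>0 \<le> \<theta>\<close>
    by (intro norm_blinfun_bound) (auto simp: abs_le_iff blinfun.minus_right)
  then show False using \<open>\<theta> < norm \<phi>\<close> by simp
qed

text \<open>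
Uniform convexity of the dual, in the form in which it is used: two unit functionals that nearly
attain their norms at a common point are close.
\<close>

lemma uniformly_smooth_close:
  assumes us: "uniformly_smooth_space TYPE('a::real_normed_vector)" and "\<epsilon> > 0"
  obtains \<eta> where "\<eta> > 0"
    "\<And>(\<phi> :: 'a \<Rightarrow>\<^sub>L real) \<psi> v. norm \<phi> = 1 \<Longrightarrow> norm \<psi> = 1 \<Longrightarrow> norm v \<le> 1 \<Longrightarrow>
        1 - \<eta> \<le> blinfun_apply \<phi> v \<Longrightarrow> 1 - \<eta> \<le> blinfun_apply \<psi> v \<Longrightarrow> norm (\<phi> - \<psi>) < \<epsilon>"
proof -
  define \<epsilon>' where "\<epsilon>' = min \<epsilon> 2"
  have "0 < \<epsilon>'" "\<epsilon>' \<le> 2" using \<open>\<epsilon> > 0\<close> by (auto simp: \<epsilon>'_def)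
  then obtain \<delta> where \<delta>: "\<delta> > 0" "\<And>(\<phi> :: 'a \<Rightarrow>\<^sub>L real) \<psi>. norm \<phi> = 1 \<Longrightarrow> norm \<psi> = 1 \<Longrightarrow>
      norm (\<phi> - \<psi>) \<ge> \<epsilon>' \<Longrightarrow> norm (\<phi> + \<psi>) \<le> 2 - \<delta>"
    using us unfolding uniformly_smooth_space_def uniformly_convex_space_def by metis
  show thesis
  proof (rule that[of "\<delta> / 4"])
    fix \<phi> \<psi> :: "'a \<Rightarrow>\<^sub>L real" and v :: 'a
    assume *: "norm \<phi> = 1" "norm \<psi> = 1" "norm v \<le> 1" "1 - \<delta> / 4 \<le> \<phi> v" "1 - \<delta> / 4 \<le> \<psi> v"
    have "(\<phi> + \<psi>) v \<le> norm (\<phi> + \<psi>) * norm v"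
      using norm_blinfun[of "\<phi> + \<psi>" v] by simp
    also have "\<dots> \<le> norm (\<phi> + \<psi>)" using \<open>norm v \<le> 1\<close> by (simp add: mult_left_le)
    finally have "norm (\<phi> + \<psi>) > 2 - \<delta>" using * \<delta>(1) by (simp add: blinfun.add_left)
    then have "norm (\<phi> - \<psi>) < \<epsilon>'" using \<delta>(2)[of \<phi> \<psi>] * by fastforce
    then show "norm (\<phi> - \<psi>) < \<epsilon>" by (simp add: \<epsilon>'_def)
  qed (use \<delta> in simp)
qed

text \<open>
A one-step Hahn-Banach extension: the restriction of \<open>F\<close> to the kernel of \<open>E\<close> extends to
the whole space with the bound \<open>\<theta>\<close>, and the extension differs from \<open>F\<close> by a multiple of \<open>E\<close>.
\<close>

lemma close_to_multiple_if_small_on_kernel: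
  fixes F E :: "'b::real_normed_vector \<Rightarrow>\<^sub>L real"
  assumes \<theta>: "\<theta> \<ge> 0" and small: "\<And>y. E y = 0 \<Longrightarrow> F y \<le> \<theta> * norm y"
  obtains c where "norm (F - c *\<^sub>R E) \<le> \<theta>"
proof -
  have "\<exists>c. \<forall>y. F y - c * E y \<le> \<theta> * norm y"
  proof (cases "\<exists>y. E y \<noteq> 0")
    case False
    then show ?thesis using small by auto
  next
    case True
    then obtain y where y: "E y \<noteq> 0" by blast
    define e where "e = inverse (E y) *\<^sub>R y"
    have e: "E e = 1" using y by (simp add: e_def blinfun.scaleR_right)
    \<comment> \<open>This will be the value at \<open>e\<close> of the extension of \<open>F\<close> from the kernel of \<open>E\<close>.\<close>
    define \<gamma> where "\<gamma> = (SUP n\<in>{n. E n = 0}. F n - \<theta> * norm (n - e))"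
    have sep: "F n - \<theta> * norm (n - e) \<le> \<theta> * norm (m + e) - F m"
      if "E n = 0" "E m = 0" for n m
    proof -
      have "F n + F m = F (n + m)" by (simp add: blinfun.add_right)
      also have "\<dots> \<le> \<theta> * norm (n + m)" using that by (intro small) (simp add: blinfun.add_right)
      also have "\<dots> \<le> \<theta> * (norm (n - e) + norm (m + e))"
        using norm_triangle_ineq[of "n - e" "m + e"] \<theta> by (intro mult_left_mono) auto
      finally show ?thesis by (simp add: algebra_simps)
    qed
    have E0: "E 0 = 0" by (simp add: blinfun.zero_right)
    have bdd: "bdd_above ((\<lambda>n. F n - \<theta> * norm (n - e)) ` {n. E n = 0})"
      using sep[OF _ E0] by (intro bdd_aboveI2) auto
    have lower: "F n - \<theta> * norm (n - e) \<le> \<gamma>" if "E n = 0" for n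
      unfolding \<gamma>_def using that by (intro cSUP_upper[OF _ bdd]) auto
    have upper: "\<gamma> \<le> \<theta> * norm (m + e) - F m" if "E m = 0" for m
      unfolding \<gamma>_def using sep[OF _ that] E0 by (intro cSUP_least) (blast, simp)
    have "F y - (F e - \<gamma>) * E y \<le> \<theta> * norm y" for y
    proof -
      define a n where "a = E y" and "n = y - a *\<^sub>R e"
      have n: "E n = 0" using e by (simp add: n_def a_def blinfun.diff_right blinfun.scaleR_right)
      have Fy: "F y - (F e - \<gamma>) * E y = F n + a * \<gamma>"
        by (simp add: n_def a_def blinfun.diff_right blinfun.scaleR_right algebra_simps)
      consider "a = 0" | "a > 0" | "a < 0" by linarith
      then show ?thesis
      proof cases
        case 1
        then show ?thesis using small[of y] by (simp add: a_def)
      next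
        case 2
        have eq: "inverse a *\<^sub>R n + e = inverse a *\<^sub>R y" using 2 by (simp add: n_def algebra_simps)
        show ?thesis
          using upper[of "inverse a *\<^sub>R n", unfolded eq] n 2 unfolding Fy
          by (simp add: blinfun.scaleR_right field_simps)
      next
        case 3
        define b where "b = - a"
        have b: "b > 0" "a = - b" using 3 by (auto simp: b_def)
        have eq: "inverse b *\<^sub>R n - e = inverse b *\<^sub>R y" using b by (simp add: n_def algebra_simps)
        show ?thesis
          using lower[of "inverse b *\<^sub>R n", unfolded eq] n b unfolding Fy
          by (simp add: blinfun.scaleR_right field_simps)
      qed
    qed
    then show ?thesis by blast
  qed
  then obtain c where c: "\<And>y. F y - c * E y \<le> \<theta> * norm y" by blast
  have "norm (F - c *\<^sub>R E) \<le> \<theta>"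
    using c c[of "- _"] \<theta>
    by (intro norm_blinfun_bound)
      (auto simp: abs_le_iff blinfun.diff_left blinfun.scaleR_left blinfun.minus_right algebra_simps)
  then show thesis by (rule that)
qed

text \<open>
The canonical embedding into the bidual.
\<close>

definition evaluation :: "'a::real_normed_vector \<Rightarrow> ('a \<Rightarrow>\<^sub>L real) \<Rightarrow>\<^sub>L real" where
  "evaluation x = Blinfun (\<lambda>\<phi>. blinfun_apply \<phi> x)"

lemma evaluation_apply [simp]: "evaluation x \<phi> = blinfun_apply \<phi> x"
  unfolding evaluation_def
  by (simp add: bounded_linear_Blinfun_apply blinfun.bounded_linear_left)

lemma norm_evaluation: "norm (evaluation x) = norm x"
proof (rule antisym)
  have "norm (evaluation x \<phi>) \<le> norm x * norm \<phi>" for \<phi>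
    using norm_blinfun[of \<phi> x] by (simp add: mult.commute)
  then show "norm (evaluation x) \<le> norm x" by (intro norm_blinfun_bound) auto
  obtain \<phi> :: "'a \<Rightarrow>\<^sub>L real" where \<phi>: "norm \<phi> \<le> 1" "\<phi> x = norm x"
    by (rule norming_functional)
  have "norm x = norm (evaluation x \<phi>)" using \<phi> by simp
  also have "\<dots> \<le> norm (evaluation x) * norm \<phi>" by (rule norm_blinfun)
  also have "\<dots> \<le> norm (evaluation x)" using \<phi>(1) by (simp add: mult_left_le)
  finally show "norm x \<le> norm (evaluation x)" .
qed

lemma bounded_linear_evaluation: "bounded_linear evaluation"
proof (rule bounded_linear_intro[where K = 1])
  show "evaluation (x + y) = evaluation x + evaluation y" for x y :: 'a
    by (rule blinfun_eqI) (simp add: blinfun.add_right blinfun.add_left)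
  show "evaluation (r *\<^sub>R x) = r *\<^sub>R evaluation x" for r and x :: 'a
    by (rule blinfun_eqI) (simp add: blinfun.scaleR_right blinfun.scaleR_left)
qed (simp add: norm_evaluation)

lemma closed_range_evaluation:
  "closed (range (evaluation :: 'a::banach \<Rightarrow> ('a \<Rightarrow>\<^sub>L real) \<Rightarrow>\<^sub>L real))"
proof (intro complete_imp_closed complete_isometric_image)
  show "(0::real) < 1" by simp
qed (simp_all add: bounded_linear_evaluation norm_evaluation complete_UNIV)

text \<open>
Riesz's lemma for the image of the space in its bidual, which is closed by completeness.
\<close>

lemma almost_orthogonal_to_evaluations:
  fixes F :: "('a::banach \<Rightarrow>\<^sub>L real) \<Rightarrow>\<^sub>L real"
  assumes F: "F \<notin> range evaluation" and \<theta>: "0 < \<theta>" "\<theta> < 1"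
  obtains G :: "('a \<Rightarrow>\<^sub>L real) \<Rightarrow>\<^sub>L real" where "norm G > 0"
    "\<And>x. \<theta> * norm G < norm (G - evaluation x)"
proof -
  define d where "d = infdist F (range evaluation)"
  have d: "d > 0"
    unfolding d_def by (rule infdist_pos_not_in_closed[OF closed_range_evaluation _ F]) auto
  have d_le: "d \<le> norm (F - evaluation x)" for x
    unfolding d_def using infdist_le[of "evaluation x" "range evaluation" F] by (simp add: dist_norm)
  have "\<exists>x. norm (F - evaluation x) < d / \<theta>"
  proof (rule ccontr)
    assume "\<not> ?thesis"
    then have "d / \<theta> \<le> d"
      unfolding d_def infdist_def by (auto simp: dist_norm not_less intro!: cINF_greatest)
    then show False using d \<theta> by (simp add: field_simps)
  qed
  then obtain x where x: "norm (F - evaluation x) < d / \<theta>" by blast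
  define G where "G = F - evaluation x"
  have "\<theta> * norm G < norm (G - evaluation y)" for y
  proof -
    have "\<theta> * norm G < d" using x \<theta> by (simp add: G_def field_simps)
    also have "d \<le> norm (F - evaluation (x + y))" by (rule d_le)
    also have "F - evaluation (x + y) = G - evaluation y"
      by (simp add: G_def linear_simps[OF bounded_linear_evaluation])
    finally show ?thesis .
  qed
  moreover have "norm G > 0" unfolding G_def using d_le[of x] d by linarith
  ultimately show thesis using that by blast
qed

text \<open>
Suppose that some element of the bidual is no evaluation. Then there is a \<open>G\<close> almost orthogonal to all
evaluations. Take a unit functional \<open>\<phi>\<close> almost norming \<open>G\<close> and a unit vector \<open>x\<close> with
\<open>\<phi> x > 1/2\<close>. Since \<open>G\<close> keeps almost its full norm on the functionals vanishing at \<open>x\<close>, there is a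
unit functional \<open>\<psi>\<close> with \<open>\<psi> x = 0\<close> that also almost norms \<open>G\<close>. So \<open>\<phi> + \<psi>\<close> has norm almost \<open>2\<close>
although \<open>\<phi>\<close> and \<open>\<psi>\<close> differ by at least \<open>1/2\<close> at \<open>x\<close>, against uniform convexity of the dual.
\<close>

lemma uniformly_smooth_imp_reflexive:
  fixes F :: "('a::banach \<Rightarrow>\<^sub>L real) \<Rightarrow>\<^sub>L real"
  assumes us: "uniformly_smooth_space TYPE('a)"
  obtains x where "F = evaluation x"
proof (cases "F \<in> range evaluation")
  case False
  obtain \<delta> where \<delta>: "\<delta> > 0" "\<And>(\<phi> :: 'a \<Rightarrow>\<^sub>L real) \<psi>. norm \<phi> = 1 \<Longrightarrow> norm \<psi> = 1 \<Longrightarrow>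
      norm (\<phi> - \<psi>) \<ge> 1/2 \<Longrightarrow> norm (\<phi> + \<psi>) \<le> 2 - \<delta>"
    using us[unfolded uniformly_smooth_space_def uniformly_convex_space_def, rule_format, of "1/2"]
    by auto
  \<comment> \<open>Close enough to \<open>1\<close> that \<open>2 * \<theta>\<close> exceeds \<open>2 - \<delta>\<close>.\<close>
  define \<theta> where "\<theta> = max (1/2) (1 - \<delta> / 4)"
  have \<theta>: "0 < \<theta>" "\<theta> < 1" "1 - \<delta> / 2 < \<theta>" using \<delta>(1) by (auto simp: \<theta>_def max_def)
  obtain G :: "('a \<Rightarrow>\<^sub>L real) \<Rightarrow>\<^sub>L real" where G: "norm G > 0"
    "\<And>x. \<theta> * norm G < norm (G - evaluation x)"
    using almost_orthogonal_to_evaluations[OF False \<theta>(1,2)] by blast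
  have "\<theta> * norm G < norm G" using \<theta> G by simp
  then obtain \<phi> where \<phi>: "norm \<phi> = 1" "\<theta> * norm G < G \<phi>"
    using blinfun_exceeds[of "\<theta> * norm G" G] \<theta> by (metis less_eq_real_def mult_nonneg_nonneg norm_ge_zero)
  obtain x where x: "norm x = 1" "1/2 < \<phi> x"
    using blinfun_exceeds[of "1/2" \<phi>] \<phi>(1) by auto
  have "\<exists>\<psi>. evaluation x \<psi> = 0 \<and> \<theta> * norm G * norm \<psi> < G \<psi>"
  proof (rule ccontr)
    assume "\<not> ?thesis"
    then obtain c where "norm (G - c *\<^sub>R evaluation x) \<le> \<theta> * norm G"
      using close_to_multiple_if_small_on_kernel[of "\<theta> * norm G" "evaluation x" G] \<theta>
      by (metis less_eq_real_def mult_nonneg_nonneg norm_ge_zero not_less)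
    then show False
      using G(2)[of "c *\<^sub>R x"] by (simp add: linear_simps[OF bounded_linear_evaluation])
  qed
  then obtain \<psi>' :: "'a \<Rightarrow>\<^sub>L real" where \<psi>': "\<psi>' x = 0" "\<theta> * norm G * norm \<psi>' < G \<psi>'" by auto
  then have "\<psi>' \<noteq> 0" by (auto simp: blinfun.zero_right)
  define \<psi> where "\<psi> = inverse (norm \<psi>') *\<^sub>R \<psi>'"
  have \<psi>: "norm \<psi> = 1" "\<psi> x = 0" "\<theta> * norm G < G \<psi>"
    using \<psi>' \<open>\<psi>' \<noteq> 0\<close> by (auto simp: \<psi>_def blinfun.scaleR_left blinfun.scaleR_right field_simps)
  have "norm ((\<phi> - \<psi>) x) \<le> norm (\<phi> - \<psi>) * norm x" by (rule norm_blinfun)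
  then have "1/2 \<le> norm (\<phi> - \<psi>)" using x \<psi> by (simp add: blinfun.diff_left)
  then have "norm (\<phi> + \<psi>) \<le> 2 - \<delta>" using \<delta>(2) \<phi> \<psi> by blast
  have "2 * (\<theta> * norm G) < G (\<phi> + \<psi>)" using \<phi> \<psi> by (simp add: blinfun.add_right)
  also have "\<dots> \<le> norm G * norm (\<phi> + \<psi>)" using norm_blinfun[of G "\<phi> + \<psi>"] by simp
  also have "\<dots> \<le> norm G * (2 - \<delta>)" using \<open>norm (\<phi> + \<psi>) \<le> 2 - \<delta>\<close> by (intro mult_left_mono) auto
  finally have "norm G * (2 * \<theta>) < norm G * (2 - \<delta>)" by (simp add: algebra_simps)
  then show thesis using G(1) \<theta>(3) by simp
qed (use that in blast)

text \<open>
A norm-one element of the bidual norming \<open>\<phi>\<close> is evaluation at a point.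
\<close>

lemma uniformly_smooth_attains_norm:
  fixes \<phi> :: "'a::banach \<Rightarrow>\<^sub>L real"
  assumes us: "uniformly_smooth_space TYPE('a)" and \<phi>: "norm \<phi> = 1"
  obtains x where "norm x = 1" "\<phi> x = 1"
proof -
  obtain F :: "('a \<Rightarrow>\<^sub>L real) \<Rightarrow>\<^sub>L real" where F: "norm F \<le> 1" "F \<phi> = norm \<phi>"
    by (rule norming_functional)
  obtain x where x: "F = evaluation x" by (rule uniformly_smooth_imp_reflexive[OF us])
  have "norm x \<le> 1" "\<phi> x = 1" using F \<phi> by (auto simp: x norm_evaluation)
  moreover have "\<phi> x \<le> norm x" by (rule blinfun_apply_le(1)) (simp add: \<phi>)
  ultimately show thesis using that by simp
qed

section \<open>Displacement in uniformly smooth spaces\<close>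

text \<open>
The dissipativity inequality between a resolvent point \<open>x\<close> and an arbitrary point \<open>y\<close>: the loss
from norming \<open>x - y\<close> in place of \<open>x\<close> is at most \<open>2 s \<parallel>y\<parallel>\<close>, which is negligible for small \<open>s\<close>.
\<close>

lemma resolvent_norming_functional_lower:
  fixes g :: "'a::real_normed_vector \<Rightarrow> 'a" and \<phi> :: "'a \<Rightarrow>\<^sub>L real"
  assumes g: "nonexpansive_on UNIV g" and "s \<ge> 0" and x: "g x - x = s *\<^sub>R x"
    and \<phi>: "norm \<phi> \<le> 1" "\<phi> (x - y) = norm (x - y)"
  shows "norm x - 2 * norm y \<le> \<phi> x" and "s * norm x - 2 * s * norm y \<le> \<phi> (g y - y)"
proof -
  have "norm x - norm y \<le> \<phi> x - \<phi> y"
    using norm_triangle_ineq2[of x y] \<phi>(2) by (simp add: blinfun.diff_right)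
  then show 1: "norm x - 2 * norm y \<le> \<phi> x"
    using blinfun_apply_le(2)[OF \<phi>(1), of y] by simp
  have "\<phi> (g x - g y) \<le> norm (g x - g y)" by (rule blinfun_apply_le(1)[OF \<phi>(1)])
  also have "\<dots> \<le> \<phi> (x - y)" using nonexpansiveD[OF g] \<phi>(2) by simp
  finally have "\<phi> (g x - x) \<le> \<phi> (g y - y)" by (simp add: blinfun.diff_right)
  then have "s * \<phi> x \<le> \<phi> (g y - y)" by (simp add: x blinfun.scaleR_right)
  moreover have "s * (norm x - 2 * norm y) \<le> s * \<phi> x"
    using 1 \<open>s \<ge> 0\<close> by (rule mult_left_mono)
  ultimately show "s * norm x - 2 * s * norm y \<le> \<phi> (g y - y)" by (simp add: algebra_simps)
qed

lemma norm_one_if_norming: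
  fixes \<phi> :: "'a::real_normed_vector \<Rightarrow>\<^sub>L real"
  assumes "norm \<phi> \<le> 1" "\<phi> x = norm x" "x \<noteq> 0"
  shows "norm \<phi> = 1"
proof (rule antisym)
  have "1 * norm x \<le> norm \<phi> * norm x" using norm_blinfun[of \<phi> x] assms(2) by simp
  then show "1 \<le> norm \<phi>" using \<open>x \<noteq> 0\<close> by simp
qed (fact assms(1))

text \<open>
The functionals \<open>\<psi> n\<close> norming the resolvent points \<open>x n\<close> for parameters \<open>s n\<close> tending to \<open>0\<close> satisfy
\<open>\<psi> n (g y - y) \<ge> d - \<epsilon>\<close> eventually, for each \<open>y\<close>, where \<open>d\<close> is the least displacement. If
\<open>\<parallel>g y - y\<parallel>\<close> is close to \<open>d\<close>, all late \<open>\<psi> n\<close> nearly attain their norms in the direction of \<open>g y - y\<close>;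
hence they are close to each other, and the sequence is Cauchy.
\<close>

lemma uniformly_smooth_displacement_functional:
  fixes g :: "'a::banach \<Rightarrow> 'a"
  assumes us: "uniformly_smooth_space TYPE('a)" and g: "nonexpansive_on UNIV g"
    and away: "d0 > 0" "\<And>x. d0 \<le> norm (g x - x)"
  obtains \<phi> :: "'a \<Rightarrow>\<^sub>L real" where "norm \<phi> = 1" "\<And>y. 0 \<le> \<phi> (g y - y)"
proof -
  define d where "d = (INF x. norm (g x - x))"
  have bdd: "bdd_below (range (\<lambda>x. norm (g x - x)))" by (intro bdd_belowI2[of _ 0]) auto
  have d_le: "d \<le> norm (g x - x)" for x unfolding d_def by (rule cINF_lower[OF bdd]) auto
  have "d0 \<le> d" unfolding d_def using away by (intro cINF_greatest) auto
  then have d: "d > 0" using away by simp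
  define s where "s n = inverse (real (Suc n))" for n
  have s: "s n > 0" for n by (simp add: s_def)
  have s_lim: "s \<longlonglongrightarrow> 0" unfolding s_def by (rule LIMSEQ_inverse_real_of_nat)
  have "\<exists>x. g x - x = s n *\<^sub>R x" for n
    using resolvent_exists[OF g s] by blast
  then obtain x where x: "\<And>n. g (x n) - x n = s n *\<^sub>R x n"
    by metis
  have sx: "d \<le> s n * norm (x n)" for n using d_le[of "x n"] s[of n] by (simp add: x)
  have x_pos: "norm (x n) > 0" for n
    using sx[of n] d s[of n] by (metis less_le_trans zero_less_mult_pos)
  have "\<exists>j :: 'a \<Rightarrow>\<^sub>L real. norm j = 1 \<and> blinfun_apply j (x n - y) = norm (x n - y)" if "x n \<noteq> y" for n y
    using norming_functional[of "x n - y"] norm_one_if_norming that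
    by (metis right_minus_eq)
  then obtain j :: "nat \<Rightarrow> 'a \<Rightarrow> 'a \<Rightarrow>\<^sub>L real"
    where j: "\<And>n y. x n \<noteq> y \<Longrightarrow> norm (j n y) = 1 \<and> j n y (x n - y) = norm (x n - y)"
    by metis
  define \<psi> where "\<psi> n = j n 0" for n
  have \<psi>: "norm (\<psi> n) = 1" "\<psi> n (x n) = norm (x n)" for n
    using j[of n 0] x_pos[of n] by (auto simp: \<psi>_def)
  have key: "\<forall>\<^sub>F n in sequentially. d - \<epsilon> \<le> \<psi> n (g y - y)" if \<epsilon>: "\<epsilon> > 0" for y \<epsilon>
  proof -
    define K where "K = norm (g y - y)"
    have K: "K > 0" unfolding K_def using d_le[of y] d by linarith
    obtain \<eta> where \<eta>: "\<eta> > 0" and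
      close: "\<And>(\<phi> :: 'a \<Rightarrow>\<^sub>L real) \<psi> v. norm \<phi> = 1 \<Longrightarrow> norm \<psi> = 1 \<Longrightarrow> norm v \<le> 1 \<Longrightarrow>
        1 - \<eta> \<le> blinfun_apply \<phi> v \<Longrightarrow> 1 - \<eta> \<le> blinfun_apply \<psi> v \<Longrightarrow> norm (\<phi> - \<psi>) < \<epsilon> / (2 * K)"
      using uniformly_smooth_close[OF us, of "\<epsilon> / (2 * K)"] \<epsilon> K by auto
    have sy: "(\<lambda>n. s n * (2 * norm y)) \<longlonglongrightarrow> 0" by (rule tendsto_mult_left_zero[OF s_lim])
    \<comment> \<open>The first condition separates \<open>x n\<close> from \<open>y\<close>, the second makes \<open>j n y\<close> and \<open>\<psi> n\<close> nearly attain
      their norms at the direction of \<open>x n\<close>, the third bounds the loss in dissipativity.\<close>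
    have "\<forall>\<^sub>F n in sequentially. s n * (2 * norm y) < d"
      "\<forall>\<^sub>F n in sequentially. s n * (2 * norm y) < \<eta> * d"
      "\<forall>\<^sub>F n in sequentially. s n * (2 * norm y) < \<epsilon> / 2"
      by (rule order_tendstoD(2)[OF sy], use d \<eta> \<epsilon> in simp)+
    then show ?thesis
    proof eventually_elim
      case (elim n)
      have "s n * (2 * norm y) < s n * norm (x n)" using elim(1) sx[of n] by simp
      then have "2 * norm y < norm (x n)" using s[of n] by simp
      then have "x n \<noteq> y" using norm_ge_zero[of y] by auto
      then have jn: "norm (j n y) = 1" "j n y (x n - y) = norm (x n - y)" using j by auto
      have l1: "norm (x n) - 2 * norm y \<le> j n y (x n)"
        and l2: "s n * norm (x n) - 2 * s n * norm y \<le> j n y (g y - y)"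
        using resolvent_norming_functional_lower[OF g less_imp_le[OF s] x, of "j n y" n y] jn by auto
      define v where "v = inverse (norm (x n)) *\<^sub>R x n"
      have v: "norm v = 1" using x_pos[of n] by (simp add: v_def)
      have "s n * (2 * norm y) \<le> \<eta> * (s n * norm (x n))"
        using elim(2) sx[of n] \<eta> by (smt (verit) mult_left_mono)
      then have "2 * norm y \<le> \<eta> * norm (x n)" using s[of n] by (simp add: mult.left_commute)
      then have "(1 - \<eta>) * norm (x n) \<le> j n y (x n)" using l1 by (simp add: algebra_simps)
      then have "1 - \<eta> \<le> j n y v"
        using x_pos[of n] by (simp add: v_def blinfun.scaleR_right field_simps)
      moreover have "1 - \<eta> \<le> \<psi> n v"
        using \<psi>(2)[of n] x_pos[of n] \<eta> by (simp add: v_def blinfun.scaleR_right)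
      ultimately have "norm (j n y - \<psi> n) < \<epsilon> / (2 * K)"
        by (intro close[of _ _ v]) (simp_all add: jn(1) \<psi>(1) v)
      then have "norm (j n y - \<psi> n) * K \<le> \<epsilon> / 2" using K by (simp add: field_simps)
      then have "(j n y - \<psi> n) (g y - y) \<le> \<epsilon> / 2"
        using norm_blinfun[of "j n y - \<psi> n" "g y - y"] by (simp add: K_def)
      then show "d - \<epsilon> \<le> \<psi> n (g y - y)"
        using l2 elim(3) sx[of n] by (simp add: blinfun.diff_left)
    qed
  qed
  have "Cauchy \<psi>"
  proof (rule metric_CauchyI)
    fix \<epsilon> :: real assume "\<epsilon> > 0"
    then obtain \<eta> where \<eta>: "\<eta> > 0" and
      close: "\<And>(\<phi> :: 'a \<Rightarrow>\<^sub>L real) \<psi> v. norm \<phi> = 1 \<Longrightarrow> norm \<psi> = 1 \<Longrightarrow> norm v \<le> 1 \<Longrightarrow>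
        1 - \<eta> \<le> blinfun_apply \<phi> v \<Longrightarrow> 1 - \<eta> \<le> blinfun_apply \<psi> v \<Longrightarrow> norm (\<phi> - \<psi>) < \<epsilon>"
      using uniformly_smooth_close[OF us] by blast
    have "\<exists>y. norm (g y - y) < d + d * \<eta> / 2"
    proof (rule ccontr)
      assume "\<not> ?thesis"
      then have "d + d * \<eta> / 2 \<le> d" unfolding d_def by (intro cINF_greatest) (auto simp: not_less)
      then show False using d \<eta> by (simp add: mult_le_0_iff)
    qed
    then obtain y where y: "norm (g y - y) < d + d * \<eta> / 2" by blast
    define K v where "K = norm (g y - y)" and "v = inverse K *\<^sub>R (g y - y)"
    have K: "K > 0" "d \<le> K" unfolding K_def using d_le[of y] d by linarith+
    have v: "norm v = 1" using K by (simp add: v_def K_def)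
    have "d * \<eta> / 2 > 0" using d \<eta> by simp
    then obtain N where N: "\<And>n. n \<ge> N \<Longrightarrow> d - d * \<eta> / 2 \<le> \<psi> n (g y - y)"
      using key unfolding eventually_sequentially by blast
    have "1 - \<eta> \<le> \<psi> n v" if "n \<ge> N" for n
    proof -
      have "(1 - \<eta>) * K \<le> K - d * \<eta>" using K \<eta> by (simp add: algebra_simps)
      also have "\<dots> \<le> \<psi> n (g y - y)" using y N[OF that] by (simp add: K_def)
      finally have "1 - \<eta> \<le> \<psi> n (g y - y) / K" using K(1) by (simp add: pos_le_divide_eq)
      then show ?thesis by (simp add: v_def blinfun.scaleR_right divide_inverse mult.commute)
    qed
    then have "\<forall>m\<ge>N. \<forall>n\<ge>N. dist (\<psi> m) (\<psi> n) < \<epsilon>"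
      unfolding dist_norm by (auto intro!: close[of _ _ v] simp: \<psi>(1) v)
    then show "\<exists>M. \<forall>m\<ge>M. \<forall>n\<ge>M. dist (\<psi> m) (\<psi> n) < \<epsilon>" by blast
  qed
  then obtain \<phi> where lim: "\<psi> \<longlonglongrightarrow> \<phi>" using Cauchy_convergent convergent_def by blast
  have "(\<lambda>n. norm (\<psi> n)) \<longlonglongrightarrow> norm \<phi>" by (rule tendsto_norm[OF lim])
  then have "norm \<phi> = 1" using \<psi>(1) by (simp add: LIMSEQ_const_iff)
  moreover have "0 \<le> \<phi> (g y - y)" for y
  proof (rule tendsto_lowerbound)
    show "(\<lambda>n. \<psi> n (g y - y)) \<longlonglongrightarrow> \<phi> (g y - y)"
      by (intro tendsto_intros lim)
    show "\<forall>\<^sub>F n in sequentially. 0 \<le> \<psi> n (g y - y)"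
      using key[OF d, of y] by simp
  qed simp
  ultimately show thesis using that by blast
qed

lemma smooth_duality_map_unique:
  fixes v :: "'a::real_normed_vector"
  assumes sm: "smooth_space TYPE('a)" and v: "norm v = 1"
    and "\<phi> \<in> duality_map v" "\<psi> \<in> duality_map v"
  shows "\<phi> = \<psi>"
proof (rule ccontr)
  assume "\<phi> \<noteq> \<psi>"
  moreover have n: "norm \<phi> = 1" "norm \<psi> = 1" using assms unfolding duality_map_def by auto
  ultimately have "norm (\<phi> + \<psi>) < 2"
    using sm unfolding smooth_space_def strictly_convex_space_def by blast
  moreover have "(\<phi> + \<psi>) v = 2" using assms n by (simp add: blinfun.add_left duality_map_def)
  ultimately show False using norm_blinfun[of "\<phi> + \<psi>" v] v by simp
qed

lemma uniformly_smooth_imp_smooth: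
  assumes "uniformly_smooth_space TYPE('a::real_normed_vector)"
  shows "smooth_space TYPE('a)"
  unfolding smooth_space_def strictly_convex_space_def
proof (intro allI impI)
  fix \<phi> \<psi> :: "'a \<Rightarrow>\<^sub>L real"
  assume *: "\<phi> \<noteq> \<psi> \<and> norm \<phi> = 1 \<and> norm \<psi> = 1"
  have "0 < norm (\<phi> - \<psi>)" "norm (\<phi> - \<psi>) \<le> 2"
    using * norm_triangle_ineq4[of \<phi> \<psi>] by auto
  then obtain \<delta> where "\<delta> > 0" "norm (\<phi> + \<psi>) \<le> 2 - \<delta>"
    using assms * unfolding uniformly_smooth_space_def uniformly_convex_space_def by blast
  then show "norm (\<phi> + \<psi>) < 2" by simp
qed

text \<open>
A unit functional \<open>\<phi>\<close> with \<open>\<phi> (f y - y) \<ge> - \<phi> u\<close> for all \<open>y\<close> attains its norm at some \<open>v\<close>. By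
smoothness it is the functional that (e) provides at \<open>v\<close>, along which \<open>f (t v) - t v\<close> is unbounded below.
\<close>

lemma radially_inward_imp_dense_range:
  fixes f :: "'a::banach \<Rightarrow> 'a"
  assumes us: "uniformly_smooth_space TYPE('a)" and f: "nonexpansive_on UNIV f"
    and inward: "displacement_radially_inward f"
  shows "displacement_dense_range f"
proof (rule ccontr)
  assume "\<not> ?thesis"
  then obtain u d0 where away: "d0 > 0" "\<And>x. d0 \<le> norm (f x + u - x)"
    unfolding displacement_dense_range_iff by (meson not_less)
  obtain \<phi> :: "'a \<Rightarrow>\<^sub>L real" where \<phi>: "norm \<phi> = 1" "\<And>y. 0 \<le> \<phi> (f y + u - y)"
    using uniformly_smooth_displacement_functional[OF us nonexpansive_translate[OF f] away] by blast
  obtain v where v: "norm v = 1" "\<phi> v = 1" by (rule uniformly_smooth_attains_norm[OF us \<phi>(1)])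
  then have "\<phi> \<in> duality_map v" using \<phi>(1) duality_map_unit_iff[OF v(1), of \<phi>] by simp
  moreover obtain \<psi> where \<psi>: "\<psi> \<in> duality_map v"
    "\<forall>M. \<exists>t\<ge>0. blinfun_apply \<psi> (f (t *\<^sub>R v) - t *\<^sub>R v) \<le> M"
    using inward v unfolding displacement_radially_inward_iff[OF f] by blast
  ultimately have "\<psi> = \<phi>"
    using smooth_duality_map_unique[OF uniformly_smooth_imp_smooth[OF us] v(1)] by blast
  then obtain t where "\<phi> (f (t *\<^sub>R v) - t *\<^sub>R v) \<le> - \<phi> u - 1" using \<psi>(2) by blast
  then show False
    using \<phi>(2)[of "t *\<^sub>R v"] by (simp add: blinfun.add_right blinfun.diff_right)
qed

section \<open>Hilbert spaces\<close>

text \<open>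
The uniform boundedness principle for a Hilbert space, with the inner product as a bare bilinear form.
By the Baire category theorem some set \<open>E n\<close> of vectors whose inner products with the points of \<open>S\<close>
are at most \<open>n\<close> contains a ball around some \<open>z\<close>; adding the bound at \<open>- z\<close> moves the ball to the origin.
\<close>

lemma hilbert_uniform_boundedness:
  fixes ip :: "'a::banach \<Rightarrow> 'a \<Rightarrow> real"
  assumes sym: "\<And>x y. ip x y = ip y x"
    and add: "\<And>x y z. ip (x + y) z = ip x z + ip y z"
    and scale: "\<And>r x y. ip (r *\<^sub>R x) y = r * ip x y"
    and norm: "\<And>x. (norm x)\<^sup>2 = ip x x"
    and ptw: "\<And>z. \<exists>b. \<forall>x\<in>S. ip x z \<le> b"
  shows "bounded S"
proof -
  have add': "ip x (y + z) = ip x y + ip x z" for x y z using add sym by metis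
  have scale': "ip x (r *\<^sub>R y) = r * ip x y" for x y r using scale sym by metis
  have polar: "ip x z = ((norm (x + z))\<^sup>2 - (norm x)\<^sup>2 - (norm z)\<^sup>2) / 2" for x z
    by (simp add: norm add add' sym[of z x])
  define E where "E n = {z. \<forall>x\<in>S. ip x z \<le> real n}" for n
  have "closed {z. ip x z \<le> c}" for x c
    unfolding polar by (intro closed_Collect_le continuous_intros) simp_all
  then have "closed (\<Inter>x\<in>S. {z. ip x z \<le> real n})" for n by blast
  moreover have "(\<Inter>x\<in>S. {z. ip x z \<le> real n}) = E n" for n unfolding E_def by auto
  ultimately have closed: "closed (E n)" for n by metis
  have cover: "\<exists>n. z \<in> E n" for z
  proof -
    obtain b where b: "\<forall>x\<in>S. ip x z \<le> b" using ptw by blast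
    obtain n where "b \<le> real n" using real_arch_simple by blast
    then have "z \<in> E n" using b unfolding E_def by fastforce
    then show ?thesis by blast
  qed
  have "\<exists>n. interior (E n) \<noteq> {}"
  proof (rule ccontr)
    assume "\<not> ?thesis"
    then have "Met_TC.mtopology interior_of \<Union>(range E) = {}"
      by (intro Met_TC.metric_Baire_category_alt)
        (auto simp: mcomplete_iff_complete complete_UNIV closed)
    moreover have "\<Union>(range E) = UNIV" using cover by blast
    ultimately show False by (simp add: interior_of_topspace[of euclidean, simplified])
  qed
  then obtain n z r where z: "r > 0" "ball z r \<subseteq> E n"
    by (meson ex_in_conv mem_interior)
  obtain m where m: "- z \<in> E m" using cover by blast
  have "norm x \<le> (real n + real m) * 2 / r" if x: "x \<in> S" for x
  proof (cases "x = 0")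
    case False
    define e where "e = (r / (2 * norm x)) *\<^sub>R x"
    have "norm e < r" using False z(1) by (simp add: e_def)
    then have "z + e \<in> E n" using z by (auto simp: dist_norm intro!: subsetD[OF z(2)])
    then have "ip x (z + e) \<le> real n" "ip x (- z) \<le> real m"
      using m x unfolding E_def by auto
    moreover have "ip x (z + e) + ip x (- z) = ip x e" by (simp flip: add')
    moreover have "ip x e = r / 2 * norm x"
      using False by (simp add: e_def scale' flip: norm) (simp add: power2_eq_square)
    ultimately show ?thesis using z(1) by (simp add: field_simps)
  qed (use z in simp)
  then show ?thesis unfolding bounded_iff by blast
qed

lemma hilbert_displacement_onto_imp_fixed_points:
  fixes f :: "'a::banach \<Rightarrow> 'a"
  assumes hilbert: "hilbert_space TYPE('a)" and f: "nonexpansive_on UNIV f"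
    and onto: "displacement_onto f"
  shows "translates_have_bounded_fixed_points f"
  unfolding translates_have_bounded_fixed_points_def
proof (intro allI conjI)
  fix u
  have surj: "\<exists>x. f x - x = y" for y using onto unfolding displacement_onto_def surj_def by metis
  obtain x where "f x - x = - u" using surj by blast
  then have "f x + u = x" by (simp add: algebra_simps eq_neg_iff_add_eq_0)
  then show "{x. f x + u = x} \<noteq> {}" by blast
  obtain ip :: "'a \<Rightarrow> 'a \<Rightarrow> real"
    where sym: "\<And>x y. ip x y = ip y x"
    and add: "\<And>x y z. ip (x + y) z = ip x z + ip y z"
    and scale: "\<And>r x y. ip (r *\<^sub>R x) y = r * ip x y"
    and pos: "\<And>x. 0 \<le> ip x x" and norm: "\<And>x. norm x = sqrt (ip x x)"
    using hilbert unfolding hilbert_space_def by blast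
  have norm2: "(norm x)\<^sup>2 = ip x x" for x using pos norm by simp
  have add': "ip x (y + z) = ip x y + ip x z" for x y z using add sym by metis
  have neg: "ip (- x) y = - ip x y" for x y using scale[of "- 1"] by simp
  have neg': "ip x (- y) = - ip x y" for x y using neg sym by metis
  have monotone: "ip y (f y - y + u) \<le> ip x (f y - y + u)" if x: "f x + u = x" for x y
  proof -
    define p q where "p = x - y" and "q = f y - y + u"
    have "f x - f y = p - q" using x by (simp add: p_def q_def algebra_simps)
    then have "norm (p + - q) \<le> norm p" using nonexpansiveD[OF f, of x y] by (simp add: p_def)
    then have "(norm (p + - q))\<^sup>2 \<le> (norm p)\<^sup>2" by (rule power_mono) simp
    then have "ip (p + - q) (p + - q) \<le> ip p p" unfolding norm2 .
    then have "ip q q \<le> 2 * ip p q"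
      unfolding add add' neg neg' sym[of q p] by simp
    then have "0 \<le> ip (x + - y) q" using pos[of q] by (simp add: p_def)
    then show ?thesis unfolding add neg q_def by simp
  qed
  show "bounded {x. f x + u = x}"
  proof (rule hilbert_uniform_boundedness[OF sym add scale norm2])
    fix z
    obtain y where "f y - y = - z - u" using surj by blast
    then have "f y - y + u = - z" by simp
    then have "\<forall>x\<in>{x. f x + u = x}. ip x z \<le> ip y z"
      using monotone[of _ y] by (simp add: neg')
    then show "\<exists>b. \<forall>x\<in>{x. f x + u = x}. ip x z \<le> b" by blast
  qed
qed

section \<open>Finite-dimensional spaces with smooth norm\<close>

text \<open>
Induction on the spanning set. The balls of \<open>span B\<close> are compact, so a new vector \<open>b\<close> has positive
distance \<open>e\<close> from \<open>span B\<close>, and a bound on \<open>k b + y\<close> bounds the coefficient \<open>k\<close> and the component \<open>y\<close>.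
\<close>

lemma compact_span_Int_cball:
  fixes B :: "'a::real_normed_vector set"
  assumes "finite B"
  shows "compact (span B \<inter> cball 0 r)"
  using assms
proof (induction B arbitrary: r)
  case empty
  show ?case by (rule finite_imp_compact) simp
next
  case (insert b B)
  show ?case
  proof (cases "b \<in> span B \<or> r < 0")
    case True
    then show ?thesis using insert.IH by (auto simp: span_redundant)
  next
    case False
    then have b: "b \<notin> span B" and r: "r \<ge> 0" by auto
    have "closed (span B \<inter> cball 0 (norm b + 1))"
      using insert.IH by (rule compact_imp_closed)
    then have "open (- (span B \<inter> cball 0 (norm b + 1)))" by (rule open_Compl)
    then obtain e0 where e0: "e0 > 0" "ball b e0 \<subseteq> - (span B \<inter> cball 0 (norm b + 1))"
      using b unfolding open_contains_ball by blast
    define e where "e = min e0 1"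
    have e: "e > 0" using e0 by (simp add: e_def)
    have far: "e \<le> norm (b - y)" if y: "y \<in> span B" for y
    proof (cases "norm y \<le> norm b + 1")
      case True
      then have "y \<notin> ball b e0" using y e0(2) by auto
      then show ?thesis by (simp add: dist_norm e_def)
    next
      case False
      then have "1 \<le> norm (b - y)" using norm_triangle_ineq2[of y b] by (simp add: norm_minus_commute)
      then show ?thesis by (simp add: e_def)
    qed
    have far_scaled: "\<bar>k\<bar> * e \<le> norm (k *\<^sub>R b + y)" if y: "y \<in> span B" for k y
    proof (cases "k = 0")
      case False
      have "k *\<^sub>R b + y = k *\<^sub>R (b - (- inverse k) *\<^sub>R y)"
        using False by (simp add: algebra_simps)
      then have "norm (k *\<^sub>R b + y) = \<bar>k\<bar> * norm (b - (- inverse k) *\<^sub>R y)" by simp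
      moreover have "e \<le> norm (b - (- inverse k) *\<^sub>R y)"
        using y by (intro far span_scale)
      ultimately show ?thesis by (simp add: mult_left_mono)
    qed simp
    define M where "M = r / e"
    define P where "P = (\<lambda>(k, y). k *\<^sub>R b + y) ` ({- M..M} \<times> (span B \<inter> cball 0 (r + M * norm b)))"
    have "compact P"
      unfolding P_def case_prod_unfold
      by (intro compact_continuous_image continuous_intros compact_Times insert.IH compact_Icc)
    then have "compact (P \<inter> cball 0 r)" by (intro compact_Int_closed closed_cball)
    moreover have "P \<inter> cball 0 r = span (insert b B) \<inter> cball 0 r"
    proof (rule set_eqI)
      fix x
      have "x \<in> P" if x: "x \<in> span (insert b B)" "norm x \<le> r"
      proof -
        obtain k where "x - k *\<^sub>R b \<in> span B" using x(1) unfolding span_breakdown_eq by blast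
        then obtain y where y: "y \<in> span B" "x = k *\<^sub>R b + y"
          by (metis add.commute diff_add_cancel)
        have "\<bar>k\<bar> * e \<le> r" using far_scaled[OF y(1), of k] y(2) x(2) by simp
        then have k: "\<bar>k\<bar> \<le> M" using e by (simp add: M_def field_simps)
        have "norm y \<le> norm x + \<bar>k\<bar> * norm b"
          using norm_triangle_ineq4[of x "k *\<^sub>R b"] y(2) by simp
        also have "\<dots> \<le> r + M * norm b"
          using k x(2) by (intro add_mono mult_right_mono) auto
        finally have "(k, y) \<in> {- M..M} \<times> (span B \<inter> cball 0 (r + M * norm b))"
          using k y(1) by auto
        then show ?thesis unfolding P_def y(2) by (rule rev_image_eqI) simp
      qed
      moreover have "x \<in> span (insert b B)" if x: "x \<in> P"
      proof -
        obtain k y where "y \<in> span B" "x = k *\<^sub>R b + y" using x unfolding P_def by auto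
        then show ?thesis unfolding span_breakdown_eq by (metis add_diff_cancel_left')
      qed
      ultimately show "x \<in> P \<inter> cball 0 r \<longleftrightarrow> x \<in> span (insert b B) \<inter> cball 0 r" by auto
    qed
    ultimately show ?thesis by simp
  qed
qed

lemma finite_dimensional_compact:
  fixes S :: "'a::real_normed_vector set"
  assumes fd: "finite_dimensional_space TYPE('a)" and "bounded S" "closed S"
  shows "compact S"
proof -
  obtain B :: "'a set" where B: "finite B" "span B = UNIV"
    using fd unfolding finite_dimensional_space_def by blast
  obtain r where r: "S \<subseteq> cball 0 r"
    using \<open>bounded S\<close> unfolding bounded_iff by (auto simp: subset_iff)
  have "compact (cball (0::'a) r \<inter> S)"
    using compact_span_Int_cball[OF B(1), of r] B(2) \<open>closed S\<close> by (intro compact_Int_closed) auto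
  moreover have "cball 0 r \<inter> S = S" using r by blast
  ultimately show ?thesis by simp
qed

text \<open>
The displacement attains its minimum by compactness, and the minimum is zero because averaging \<open>g\<close>
with a constant gives contractions whose fixed points have arbitrarily small displacement.
\<close>

lemma finite_dimensional_fixed_point_property:
  assumes fd: "finite_dimensional_space TYPE('a::banach)"
  shows "fixed_point_property TYPE('a)"
  unfolding fixed_point_property_def
proof (intro allI impI, elim conjE)
  fix C :: "'a set" and g
  assume ne: "C \<noteq> {}" and C: "closed C" "bounded C" "convex C" and gC: "g \<in> C \<rightarrow> C"
    and g: "nonexpansive_on C g"
  have gn: "norm (g x - g y) \<le> norm (x - y)" if "x \<in> C" "y \<in> C" for x y
    using g that unfolding nonexpansive_on_def by blast
  have "continuous_on C g"
    unfolding continuous_on_iff dist_norm by (meson gn order_le_less_trans)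
  then have "continuous_on C (\<lambda>x. norm (g x - x))" by (intro continuous_intros)
  then obtain x0 where x0: "x0 \<in> C" and min: "\<And>y. y \<in> C \<Longrightarrow> norm (g x0 - x0) \<le> norm (g y - y)"
    using continuous_attains_inf[OF finite_dimensional_compact[OF fd C(2,1)] ne] by blast
  have "g x0 = x0"
  proof (rule ccontr)
    assume "g x0 \<noteq> x0"
    then have m: "norm (g x0 - x0) > 0" by simp
    obtain c where c: "c \<in> C" using ne by blast
    obtain b where b: "b > 0" "\<And>x. x \<in> C \<Longrightarrow> norm x \<le> b" using C(2) unfolding bounded_pos by blast
    define t where "t = min (1/2) (norm (g x0 - x0) / (4 * b))"
    have t: "0 < t" "t < 1" "t * (2 * b) < norm (g x0 - x0)"
    proof -
      have "t * (2 * b) \<le> norm (g x0 - x0) / (4 * b) * (2 * b)"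
        using b by (intro mult_right_mono) (auto simp: t_def)
      also have "\<dots> < norm (g x0 - x0)" using b m by (simp add: field_simps)
      finally show "t * (2 * b) < norm (g x0 - x0)" .
    qed (use m b in \<open>auto simp: t_def\<close>)
    define h where "h x = (1 - t) *\<^sub>R g x + t *\<^sub>R c" for x
    have "h ` C \<subseteq> C"
      using gC c C(3)[unfolded convex_alt, rule_format, of _ c t] t unfolding h_def by auto
    moreover have "dist (h x) (h y) \<le> (1 - t) * dist x y" if "x \<in> C" "y \<in> C" for x y
    proof -
      have "h x - h y = (1 - t) *\<^sub>R (g x - g y)" by (simp add: h_def algebra_simps)
      then show ?thesis using gn[OF that] t by (simp add: dist_norm mult_left_mono)
    qed
    moreover have "complete C" using C(1) by (simp add: complete_eq_closed)
    ultimately have "\<exists>!x\<in>C. h x = x"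
      using ne t by (intro Banach_fix[of C "1 - t"]) auto
    then obtain x where x: "x \<in> C" "h x = x" by blast
    have "g x - x = t *\<^sub>R (g x - c)" using x(2) by (simp add: h_def algebra_simps)
    then have "norm (g x - x) = t * norm (g x - c)" using t by simp
    also have "\<dots> \<le> t * (norm (g x) + norm c)"
      using t by (intro mult_left_mono norm_triangle_ineq4) auto
    also have "\<dots> \<le> t * (2 * b)"
      using b(2)[OF funcset_mem[OF gC x(1)]] b(2)[OF c] t by (intro mult_left_mono) auto
    also have "\<dots> < norm (g x0 - x0)" by (rule t)
    finally show False using min[OF x(1)] by simp
  qed
  then show "\<exists>x\<in>C. g x = x" using x0 by blast
qed

text \<open>
Being an infimum of continuous functions, \<open>radial\<close> is upper semicontinuous also in the base
direction, and the approximation of \<open>radial v y\<close> from above is uniform for directions near \<open>v\<close>.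
\<close>

lemma radial_upper_semicontinuous:
  fixes v :: "'a::real_normed_vector"
  assumes v: "norm v = 1" and u: "\<And>n. norm (u n) = 1" "u \<longlonglongrightarrow> v"
    and R: "filterlim R at_top sequentially" and \<epsilon>: "\<epsilon> > 0"
  shows "\<forall>\<^sub>F n in sequentially. norm (R n *\<^sub>R u n + y) \<le> R n + radial v y + \<epsilon>"
proof -
  obtain s where s: "s \<ge> 0" "norm (s *\<^sub>R v + y) - s < radial v y + \<epsilon> / 2"
    using radial_approx[OF v, of "\<epsilon> / 2"] \<epsilon> by auto
  have "(\<lambda>n. norm (s *\<^sub>R u n + y)) \<longlonglongrightarrow> norm (s *\<^sub>R v + y)"
    by (intro tendsto_intros u)
  then have "\<forall>\<^sub>F n in sequentially. norm (s *\<^sub>R u n + y) < s + radial v y + \<epsilon>"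
    by (rule order_tendstoD) (use s \<epsilon> in linarith)
  moreover have "\<forall>\<^sub>F n in sequentially. s \<le> R n"
    using R unfolding filterlim_at_top by blast
  ultimately show ?thesis
  proof eventually_elim
    case (elim n)
    have "R n *\<^sub>R u n + y = (R n - s) *\<^sub>R u n + (s *\<^sub>R u n + y)" by (simp add: algebra_simps)
    also have "norm \<dots> \<le> norm ((R n - s) *\<^sub>R u n) + norm (s *\<^sub>R u n + y)"
      by (rule norm_triangle_ineq)
    also have "norm ((R n - s) *\<^sub>R u n) = R n - s" using elim(2) u(1)[of n] by simp
    finally show ?case using elim(1) by simp
  qed
qed

lemma not_bounded_sequence:
  fixes S :: "'a::real_normed_vector set"
  assumes "\<not> bounded S"
  obtains x where "\<And>n. x n \<in> S" "\<And>n::nat. real n < norm (x n)"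
proof -
  have "\<exists>x\<in>S. real n < norm x" for n using assms unfolding bounded_iff by (meson not_less)
  then show thesis using that by metis
qed

text \<open>
Let \<open>v\<close> be a limit direction of an unbounded sequence \<open>x n\<close> in \<open>F_\<delta>\<close>, and \<open>\<phi>\<close> the only element of
its duality map. Smoothness makes \<open>radial v\<close> equal to \<open>\<phi>\<close>, so \<open>\<parallel>x n + y\<parallel> - \<parallel>x n\<parallel>\<close> is asymptotically
\<open>\<phi> y\<close> from both sides. Passing to the limit in
\<open>\<parallel>f (x n) - f (t v)\<parallel> \<le> \<parallel>x n - t v\<parallel>\<close> gives \<open>\<phi> (f (t v) - t v) \<ge> - \<delta>\<close>, up to a constant, for all \<open>t\<close>.
\<close>

lemma smooth_radially_inward_imp_bounded_approx:
  fixes f :: "'a::real_normed_vector \<Rightarrow> 'a"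
  assumes fd: "finite_dimensional_space TYPE('a)"
    and sm: "smooth_space TYPE('a)"
    and f: "nonexpansive_on UNIV f" and inward: "displacement_radially_inward f"
  shows "approx_fixed_points_bounded f"
  unfolding approx_fixed_points_bounded_def
proof (intro allI impI, rule ccontr)
  fix \<delta> :: real assume "\<delta> > 0" and unbounded: "\<not> bounded (approx_fixed_points \<delta> f)"
  obtain x where x: "\<And>n. x n \<in> approx_fixed_points \<delta> f" "\<And>n. real n < norm (x n)"
    using not_bounded_sequence[OF unbounded] by blast
  have x_pos: "norm (x n) > 0" for n using x(2)[of n] of_nat_0_le_iff[of n] by linarith
  define u where "u n = inverse (norm (x n)) *\<^sub>R x n" for n
  have u: "norm (u n) = 1" "norm (x n) *\<^sub>R u n = x n" for n using x_pos[of n] by (auto simp: u_def)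
  have "compact (cball (0::'a) 1)"
    by (rule finite_dimensional_compact[OF fd bounded_cball closed_cball])
  then have "seq_compact (cball (0::'a) 1)" by (rule compact_imp_seq_compact)
  moreover have "u n \<in> cball 0 1" for n using u(1) by simp
  ultimately obtain v r where r: "strict_mono (r :: nat \<Rightarrow> nat)" and lim: "(u \<circ> r) \<longlonglongrightarrow> v"
    unfolding seq_compact_def by metis
  have "(\<lambda>n. norm ((u \<circ> r) n)) \<longlonglongrightarrow> norm v" by (rule tendsto_norm[OF lim])
  then have v: "norm v = 1" using u(1) by (simp add: LIMSEQ_const_iff)
  have "filterlim (\<lambda>n. norm (x n)) at_top sequentially"
    by (rule filterlim_at_top_mono[OF filterlim_real_sequentially]) (auto intro!: always_eventually less_imp_le x)
  then have R: "filterlim (\<lambda>n. norm (x (r n))) at_top sequentially"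
    by (rule filterlim_compose[OF _ filterlim_subseq[OF r]])
  have upper: "\<forall>\<^sub>F n in sequentially. norm (x (r n) + y) \<le> norm (x (r n)) + radial v y + 1" for y
    using radial_upper_semicontinuous[OF v _ lim R zero_less_one, of y] u by simp
  obtain \<phi> where \<phi>: "\<phi> \<in> duality_map v"
    "\<And>M. \<exists>t\<ge>0. blinfun_apply \<phi> (f (t *\<^sub>R v) - t *\<^sub>R v) \<le> M"
    using inward v unfolding displacement_radially_inward_iff[OF f] by blast
  have rad: "radial v y = \<phi> y" for y
    using radial_attained[OF v, of y] smooth_duality_map_unique[OF sm v \<phi>(1)] by metis
  have p: "\<phi> v = 1" using \<phi>(1) duality_map_unit_iff[OF v] by blast
  obtain t where t: "t \<ge> 0" "\<phi> (f (t *\<^sub>R v) - t *\<^sub>R v) \<le> - \<delta> - 3" using \<phi>(2) by blast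
  define w where "w = f (t *\<^sub>R v)"
  have "\<forall>\<^sub>F n in sequentially. False"
    using upper[of w] upper[of "- t *\<^sub>R v"]
  proof eventually_elim
    case (elim n)
    define z where "z = x (r n)"
    have "norm (f z - z) \<le> \<delta>" using x(1) by (simp add: z_def approx_fixed_points_def)
    moreover have "norm (f z - w) \<le> norm (z - t *\<^sub>R v)" unfolding w_def by (rule nonexpansiveD[OF f])
    moreover have "norm (z - w) \<le> norm (f z - w) + norm (f z - z)"
      using norm_triangle_ineq4[of "f z - w" "f z - z"] by simp
    \<comment> \<open>Convexity turns the upper estimate at \<open>z + w\<close> into a lower estimate at \<open>z - w\<close>.\<close>
    moreover have "2 * norm z \<le> norm (z + w) + norm (z - w)"
      using norm_triangle_ineq[of "z + w" "z - w"] by (simp flip: scaleR_2)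
    moreover have "norm (z + w) \<le> norm z + \<phi> w + 1" using elim(1) by (simp add: z_def rad)
    moreover have "norm (z - t *\<^sub>R v) \<le> norm z - t + 1"
      using elim(2) p by (simp add: z_def rad blinfun.minus_right blinfun.scaleR_right)
    moreover have "\<phi> w \<le> t - \<delta> - 3"
      using t p by (simp add: w_def blinfun.diff_right blinfun.scaleR_right)
    ultimately show False by linarith
  qed
  then show False by simp
qed

section \<open>Polyhedral norms as maxima of linear functionals\<close>

definition conic_span :: "'a::real_vector set \<Rightarrow> 'a set" where
  "conic_span S = {x. \<exists>c. (\<forall>s\<in>S. 0 \<le> c s) \<and> x = (\<Sum>s\<in>S. c s *\<^sub>R s)}"

definition halfspace_cone :: "'a::real_vector set \<Rightarrow> bool" where
  "halfspace_cone K \<longleftrightarrow>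
    (\<exists>\<Psi>. finite \<Psi> \<and> (\<forall>\<psi>\<in>\<Psi>. linear \<psi>) \<and> K = {x. \<forall>\<psi>\<in>\<Psi>. (0::real) \<le> \<psi> x})"

lemma halfspace_coneI:
  assumes "finite \<Psi>" "\<And>\<psi>. \<psi> \<in> \<Psi> \<Longrightarrow> linear \<psi>"
    and "\<And>x. x \<in> K \<longleftrightarrow> (\<forall>\<psi>\<in>\<Psi>. (0::real) \<le> \<psi> x)"
  shows "halfspace_cone K"
  unfolding halfspace_cone_def using assms by (intro exI[of _ \<Psi>]) auto

lemma halfspace_coneE:
  assumes "halfspace_cone K"
  obtains \<Psi> where "finite \<Psi>" "\<forall>\<psi>\<in>\<Psi>. linear \<psi>" "\<forall>x. x \<in> K \<longleftrightarrow> (\<forall>\<psi>\<in>\<Psi>. (0::real) \<le> \<psi> x)"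
proof -
  obtain \<Psi> where \<Psi>: "finite \<Psi>" "\<forall>\<psi>\<in>\<Psi>. linear \<psi>" "K = {x. \<forall>\<psi>\<in>\<Psi>. (0::real) \<le> \<psi> x}"
    using assms unfolding halfspace_cone_def by blast
  show thesis by (rule that[OF \<Psi>(1,2)]) (simp add: \<Psi>(3))
qed

lemma conic_span_insert:
  assumes "finite S" "a \<notin> S"
  shows "conic_span (insert a S) = {x. \<exists>l\<ge>0. x - l *\<^sub>R a \<in> conic_span S}"
proof (rule set_eqI, rule iffI)
  fix x assume "x \<in> conic_span (insert a S)"
  then obtain c where c: "\<forall>s\<in>insert a S. 0 \<le> c s" "x = (\<Sum>s\<in>insert a S. c s *\<^sub>R s)"
    unfolding conic_span_def by blast
  then have "x - c a *\<^sub>R a = (\<Sum>s\<in>S. c s *\<^sub>R s)" using assms by simp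
  then have "x - c a *\<^sub>R a \<in> conic_span S" using c(1) unfolding conic_span_def by auto
  then show "x \<in> {x. \<exists>l\<ge>0. x - l *\<^sub>R a \<in> conic_span S}" using c(1) by auto
next
  fix x assume "x \<in> {x. \<exists>l\<ge>0. x - l *\<^sub>R a \<in> conic_span S}"
  then obtain l c where l: "l \<ge> 0" and c: "\<forall>s\<in>S. 0 \<le> c s" "x - l *\<^sub>R a = (\<Sum>s\<in>S. c s *\<^sub>R s)"
    unfolding conic_span_def by blast
  define c' where "c' = c(a := l)"
  have "(\<Sum>s\<in>S. c' s *\<^sub>R s) = (\<Sum>s\<in>S. c s *\<^sub>R s)"
    using assms by (intro sum.cong) (auto simp: c'_def)
  then have "x = (\<Sum>s\<in>insert a S. c' s *\<^sub>R s)"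
    using assms c(2) by (simp add: c'_def algebra_simps)
  moreover have "\<forall>s\<in>insert a S. 0 \<le> c' s" using l c(1) by (auto simp: c'_def)
  ultimately show "x \<in> conic_span (insert a S)" unfolding conic_span_def by blast
qed

text \<open>
Fourier-Motzkin elimination of \<open>l\<close> from the system \<open>l * \<psi> a \<le> \<psi> x\<close>, \<open>0 \<le> l\<close>: the lower bounds come
from the \<open>\<psi>\<close> that are negative at \<open>a\<close> and the upper bounds from those that are positive, and
\<open>comb (p, n)\<close> says that a lower bound does not exceed an upper bound. The functionals in \<open>P\<close>
themselves compare the upper bounds with the lower bound \<open>0\<close>.
\<close>

lemma halfspace_cone_add_ray:
  fixes a :: "'a::real_vector"
  assumes "halfspace_cone K"
  shows "halfspace_cone {x. \<exists>l\<ge>0. x - l *\<^sub>R a \<in> K}"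
proof -
  obtain \<Psi> where fin: "finite \<Psi>" and lin': "\<forall>\<psi>\<in>\<Psi>. linear \<psi>"
    and K: "\<forall>x. x \<in> K \<longleftrightarrow> (\<forall>\<psi>\<in>\<Psi>. (0::real) \<le> \<psi> x)"
    by (rule halfspace_coneE[OF assms])
  note lin = lin'[rule_format]
  define N where "N = {\<psi>\<in>\<Psi>. \<psi> a < 0}"
  define P where "P = {\<psi>\<in>\<Psi>. 0 \<le> \<psi> a}"
  define comb where "comb = (\<lambda>(p, n) x. p a * n x - n a * p x :: real)"
  define \<Psi>' where "\<Psi>' = P \<union> comb ` (P \<times> N)"
  have shift: "\<psi> (x - l *\<^sub>R a) = \<psi> x - l * \<psi> a" if "\<psi> \<in> \<Psi>" for \<psi> x l
    using lin[OF that] by (simp add: linear_diff linear_scale)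
  have iff: "(\<exists>l\<ge>0. x - l *\<^sub>R a \<in> K) \<longleftrightarrow> (\<forall>\<psi>\<in>\<Psi>'. 0 \<le> \<psi> x)" for x
  proof
    assume "\<exists>l\<ge>0. x - l *\<^sub>R a \<in> K"
    then obtain l where l: "l \<ge> 0" "\<And>\<psi>. \<psi> \<in> \<Psi> \<Longrightarrow> l * \<psi> a \<le> \<psi> x"
      using K shift by force
    show "\<forall>\<psi>\<in>\<Psi>'. 0 \<le> \<psi> x"
    proof
      fix \<psi> assume "\<psi> \<in> \<Psi>'"
      then consider "\<psi> \<in> P" | p n where "\<psi> = comb (p, n)" "p \<in> P" "n \<in> N"
        unfolding \<Psi>'_def by blast
      then show "0 \<le> \<psi> x"
      proof cases
        case 1
        then have "0 \<le> l * \<psi> a" "l * \<psi> a \<le> \<psi> x" using l by (auto simp: P_def)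
        then show ?thesis by linarith
      next
        case 2
        then have p: "0 \<le> p a" "l * p a \<le> p x" and n: "n a < 0" "l * n a \<le> n x"
          using l by (auto simp: P_def N_def)
        have "p a * (l * n a) \<le> p a * n x" using n(2) p(1) by (rule mult_left_mono)
        moreover have "n a * p x \<le> n a * (l * p a)" using p(2) n(1) by (intro mult_left_mono_neg) auto
        ultimately show ?thesis using 2(1) by (simp add: comb_def mult.left_commute mult.commute)
      qed
    qed
  next
    assume *: "\<forall>\<psi>\<in>\<Psi>'. 0 \<le> \<psi> x"
    define L where "L = insert 0 ((\<lambda>n. n x / n a) ` N)"
    have L: "finite L" "L \<noteq> {}" using fin by (auto simp: L_def N_def)
    define l where "l = Max L"
    have "0 \<le> l" unfolding l_def using L by (intro Max_ge) (auto simp: L_def)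
    moreover have "x - l *\<^sub>R a \<in> K"
    proof (rule K[rule_format, THEN iffD2], intro ballI)
      fix \<psi> assume \<psi>: "\<psi> \<in> \<Psi>"
      show "0 \<le> \<psi> (x - l *\<^sub>R a)"
      proof (cases "\<psi> a < 0")
        case True
        then have "\<psi> x / \<psi> a \<le> l"
          unfolding l_def using L \<psi> by (intro Max_ge) (auto simp: L_def N_def)
        then show ?thesis unfolding shift[OF \<psi>] using True by (simp add: field_simps)
      next
        case False
        then have P: "\<psi> \<in> P" using \<psi> by (simp add: P_def)
        have "l \<in> L" unfolding l_def using L by (rule Max_in)
        then consider "l = 0" | n where "n \<in> N" "l = n x / n a" unfolding L_def by blast
        then show ?thesis
        proof cases
          case 1
          then show ?thesis using * P unfolding \<Psi>'_def by auto
        next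
          case 2
          then have n: "n a < 0" by (simp add: N_def)
          have "comb (\<psi>, n) \<in> \<Psi>'" using P 2(1) unfolding \<Psi>'_def by blast
          then have "0 \<le> \<psi> a * n x - n a * \<psi> x" using * by (force simp: comb_def)
          then show ?thesis
            unfolding shift[OF \<psi>] 2(2) using n by (simp add: field_simps)
        qed
      qed
    qed
    ultimately show "\<exists>l\<ge>0. x - l *\<^sub>R a \<in> K" by blast
  qed
  moreover have "finite \<Psi>'" using fin by (simp add: \<Psi>'_def P_def N_def)
  moreover have "linear \<psi>" if "\<psi> \<in> \<Psi>'" for \<psi>
  proof -
    have "linear (comb (p, n))" if "p \<in> \<Psi>" "n \<in> \<Psi>" for p n
      using lin[OF that(1)] lin[OF that(2)] unfolding comb_def
      by (auto intro!: linearI simp: linear_add linear_scale algebra_simps)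
    then show ?thesis using that lin unfolding \<Psi>'_def P_def N_def by auto
  qed
  ultimately show ?thesis by (intro halfspace_coneI[of \<Psi>']) auto
qed

text \<open>
Weyl's theorem: finitely generated cones are intersections of finitely many half-spaces.
\<close>

lemma halfspace_cone_conic_span:
  fixes S :: "'a::real_vector set"
  assumes zero: "halfspace_cone {0::'a}" and "finite S"
  shows "halfspace_cone (conic_span S)"
  using \<open>finite S\<close>
proof induction
  case empty
  show ?case using zero by (simp add: conic_span_def)
next
  case (insert a S)
  then show ?case by (simp add: conic_span_insert halfspace_cone_add_ray)
qed

text \<open>
The half-spaces are given by the coordinate functionals of a basis and their negatives.
\<close>

lemma halfspace_cone_zero:
  fixes B :: "'a::real_vector set"
  assumes "finite B" "span B = UNIV"
  shows "halfspace_cone {0::'a}"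
proof -
  obtain B' where B': "B' \<subseteq> B" "independent B'" "B \<subseteq> span B'"
    by (rule maximal_independent_subset)
  have sp: "span B' = UNIV" using B'(3) assms(2) span_mono[OF B'(3)] by (simp add: span_span top.extremum_unique)
  have fin: "finite B'" using B'(1) assms(1) by (rule finite_subset)
  define co where "co b x = representation B' x b" for b and x :: 'a
  have lin: "linear (co b)" for b
    unfolding co_def using B'(2) sp
    by (intro linearI) (simp_all add: representation_add representation_scale)
  define \<Psi> where "\<Psi> = co ` B' \<union> (\<lambda>b x. - co b x) ` B'"
  have "x = 0" if "\<And>\<psi>. \<psi> \<in> \<Psi> \<Longrightarrow> 0 \<le> \<psi> x" for x
  proof -
    have "co b x = 0" if "b \<in> B'" for b
      using \<open>\<And>\<psi>. \<psi> \<in> \<Psi> \<Longrightarrow> 0 \<le> \<psi> x\<close>[of "co b"] \<open>\<And>\<psi>. \<psi> \<in> \<Psi> \<Longrightarrow> 0 \<le> \<psi> x\<close>[of "\<lambda>x. - co b x"] that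
      unfolding \<Psi>_def by fastforce
    then have "(\<Sum>b\<in>B'. representation B' x b *\<^sub>R b) = 0" by (simp add: co_def)
    then show ?thesis using real_vector.sum_representation_eq[OF B'(2) _ fin order_refl, of x] sp by simp
  qed
  moreover have linear: "linear \<psi>" if "\<psi> \<in> \<Psi>" for \<psi>
    using that lin unfolding \<Psi>_def by (auto intro!: linear_compose_neg)
  moreover have "0 \<le> \<psi> 0" if "\<psi> \<in> \<Psi>" for \<psi> using linear_0[OF linear[OF that]] by simp
  ultimately have "x \<in> {0} \<longleftrightarrow> (\<forall>\<psi>\<in>\<Psi>. 0 \<le> \<psi> x)" for x by auto
  moreover have "finite \<Psi>" using fin by (simp add: \<Psi>_def)
  ultimately show ?thesis using linear by (intro halfspace_coneI[of \<Psi>])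
qed

lemma halfspace_cone_zero_prod_real:
  assumes "halfspace_cone {0::'a::real_vector}"
  shows "halfspace_cone {0::'a \<times> real}"
proof -
  obtain \<Psi> where \<Psi>: "finite \<Psi>" "\<forall>\<psi>\<in>\<Psi>. linear \<psi>"
    "\<forall>x. x \<in> {0::'a} \<longleftrightarrow> (\<forall>\<psi>\<in>\<Psi>. (0::real) \<le> \<psi> x)"
    by (rule halfspace_coneE[OF assms])
  define \<Psi>' where "\<Psi>' = insert snd (insert (\<lambda>z. - snd z) ((\<lambda>\<psi> z. \<psi> (fst z)) ` \<Psi>))"
  have "z = 0 \<longleftrightarrow> (\<forall>\<psi>\<in>\<Psi>'. 0 \<le> \<psi> z)" for z :: "'a \<times> real"
  proof -
    have "(\<forall>\<psi>\<in>\<Psi>'. 0 \<le> \<psi> z) \<longleftrightarrow> snd z = 0 \<and> (\<forall>\<psi>\<in>\<Psi>. 0 \<le> \<psi> (fst z))"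
      unfolding \<Psi>'_def by auto
    also have "(\<forall>\<psi>\<in>\<Psi>. 0 \<le> \<psi> (fst z)) \<longleftrightarrow> fst z = 0"
      using \<Psi>(3)[rule_format, of "fst z"] by simp
    finally show ?thesis by (auto simp: prod_eq_iff)
  qed
  moreover have "linear \<psi>" if "\<psi> \<in> \<Psi>'" for \<psi>
    using that \<Psi>(2) unfolding \<Psi>'_def
    by (auto intro!: linearI simp: linear_add linear_scale)
  moreover have "finite \<Psi>'" using \<Psi>(1) by (simp add: \<Psi>'_def)
  ultimately show ?thesis by (intro halfspace_coneI[of \<Psi>']) auto
qed

lemma convex_hull_as_section_of_cone:
  fixes V :: "'a::real_vector set"
  assumes "finite V"
  shows "x \<in> convex hull V \<longleftrightarrow> (x, 1::real) \<in> conic_span ((\<lambda>v. (v, 1)) ` V)"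
proof -
  have sum: "(\<Sum>s\<in>(\<lambda>v. (v, 1::real)) ` V. c s *\<^sub>R s) = (\<Sum>v\<in>V. c (v, 1) *\<^sub>R v, \<Sum>v\<in>V. c (v, 1))"
    for c :: "'a \<times> real \<Rightarrow> real"
    by (subst sum.reindex) (auto simp: inj_on_def prod_eq_iff fst_sum snd_sum)
  show ?thesis
  proof
    assume "x \<in> convex hull V"
    then obtain u where u: "\<forall>v\<in>V. 0 \<le> u v" "sum u V = 1" "(\<Sum>v\<in>V. u v *\<^sub>R v) = x"
      unfolding convex_hull_finite[OF assms] by blast
    have "(\<Sum>s\<in>(\<lambda>v. (v, 1::real)) ` V. u (fst s) *\<^sub>R s) = (x, 1)"
      unfolding sum[of "\<lambda>s. u (fst s)"] using u(2,3) by simp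
    then show "(x, 1::real) \<in> conic_span ((\<lambda>v. (v, 1)) ` V)"
      unfolding conic_span_def using u(1) by (intro CollectI exI[of _ "\<lambda>s. u (fst s)"]) auto
  next
    assume "(x, 1) \<in> conic_span ((\<lambda>v. (v, 1::real)) ` V)"
    then obtain c where "\<forall>s\<in>(\<lambda>v. (v, 1)) ` V. 0 \<le> c s"
      "(x, 1) = (\<Sum>s\<in>(\<lambda>v. (v, 1::real)) ` V. c s *\<^sub>R s)"
      unfolding conic_span_def by blast
    then show "x \<in> convex hull V"
      unfolding convex_hull_finite[OF assms] sum by (intro CollectI exI[of _ "\<lambda>v. c (v, 1)"]) auto
  qed
qed

text \<open>
The unit ball is the section at height one of a finitely generated cone, hence given by finitely many
inequalities \<open>0 \<le> \<psi> (x, 0) + \<psi> (0, 1)\<close>. Dividing by \<open>\<psi> (0, 1)\<close> turns them into \<open>\<phi> x \<le> 1\<close>, and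
homogeneity gives the norm as the maximum of the \<open>\<phi> x\<close>.
\<close>

lemma polyhedral_norm_eq_Max:
  assumes fd: "finite_dimensional_space TYPE('a::real_normed_vector)"
    and poly: "polyhedral_norm TYPE('a::real_normed_vector)"
  obtains \<Phi> :: "('a::real_normed_vector \<Rightarrow> real) set" where "finite \<Phi>" "\<And>\<phi>. \<phi> \<in> \<Phi> \<Longrightarrow> linear \<phi>"
    "\<And>\<phi> x. \<phi> \<in> \<Phi> \<Longrightarrow> \<phi> x \<le> norm x" "\<And>x. \<exists>\<phi>\<in>\<Phi>. \<phi> x = norm x"
proof -
  obtain V where V: "finite V" "cball (0::'a) 1 = convex hull V"
    using poly unfolding polyhedral_norm_def polytope_def by blast
  have "halfspace_cone {0::'a}"
    using fd halfspace_cone_zero unfolding finite_dimensional_space_def by blast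
  then have "halfspace_cone (conic_span ((\<lambda>v. (v, 1::real)) ` V))"
    using V(1) by (intro halfspace_cone_conic_span halfspace_cone_zero_prod_real) auto
  then obtain \<Psi> where fin\<Psi>: "finite \<Psi>" and lin\<Psi>: "\<forall>\<psi>\<in>\<Psi>. linear \<psi>"
    and cone: "\<forall>z. z \<in> conic_span ((\<lambda>v. (v, 1::real)) ` V) \<longleftrightarrow> (\<forall>\<psi>\<in>\<Psi>. (0::real) \<le> \<psi> z)"
    by (rule halfspace_coneE)
  note \<Psi> = fin\<Psi> lin\<Psi>[rule_format]
  have ball: "norm x \<le> 1 \<longleftrightarrow> (\<forall>\<psi>\<in>\<Psi>. 0 \<le> \<psi> (x, 0) + \<psi> (0, 1))" for x :: 'a
  proof -
    have "norm x \<le> 1 \<longleftrightarrow> x \<in> convex hull V" unfolding V(2)[symmetric] by simp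
    also have "\<dots> \<longleftrightarrow> (\<forall>\<psi>\<in>\<Psi>. 0 \<le> \<psi> (x, 1))"
      unfolding convex_hull_as_section_of_cone[OF V(1)] by (rule cone[rule_format])
    also have "\<dots> \<longleftrightarrow> (\<forall>\<psi>\<in>\<Psi>. 0 \<le> \<psi> (x, 0) + \<psi> (0, 1))"
    proof (rule ball_cong)
      fix \<psi> assume "\<psi> \<in> \<Psi>"
      then show "0 \<le> \<psi> (x, 1) \<longleftrightarrow> 0 \<le> \<psi> (x, 0) + \<psi> (0, 1)"
        using linear_add[OF \<Psi>(2), of \<psi> "(x, 0)" "(0, 1)"] by simp
    qed simp
    finally show ?thesis .
  qed
  have scale: "\<psi> (r *\<^sub>R x, 0) = r * \<psi> (x, 0)" if "\<psi> \<in> \<Psi>" for \<psi> r and x :: 'a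
    using linear_scale[OF \<Psi>(2)[OF that], of r "(x, 0)"] by simp
  have nonneg: "0 \<le> \<psi> (x, 0) + norm x * \<psi> (0, 1)" if \<psi>: "\<psi> \<in> \<Psi>" for \<psi> and x :: 'a
  proof (cases "x = 0")
    case True
    then show ?thesis using scale[OF \<psi>, of 0] by simp
  next
    case False
    have "norm (inverse (norm x) *\<^sub>R x) \<le> 1" using False by simp
    then have "0 \<le> inverse (norm x) * \<psi> (x, 0) + \<psi> (0, 1)"
      using ball \<psi> scale[OF \<psi>] by metis
    then have "0 \<le> norm x * (inverse (norm x) * \<psi> (x, 0) + \<psi> (0, 1))" by simp
    then show ?thesis using False by (simp add: distrib_left flip: mult.assoc)
  qed
  have c: "0 \<le> \<psi> (0, 1)" if \<psi>: "\<psi> \<in> \<Psi>" for \<psi>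
    using ball[of 0] \<psi> scale[OF \<psi>, of 0] by auto
  define normalise where "normalise \<psi> x = - \<psi> (x, 0) / \<psi> (0, 1)"
    for \<psi> :: "'a \<times> real \<Rightarrow> real" and x
  define \<Phi> where "\<Phi> = insert (\<lambda>_. 0) (normalise ` {\<psi>\<in>\<Psi>. 0 < \<psi> (0, 1)})"
  have fin: "finite \<Phi>" using \<Psi>(1) by (simp add: \<Phi>_def)
  have normalise_le: "normalise \<psi> x \<le> norm x" if "\<psi> \<in> \<Psi>" "0 < \<psi> (0, 1)" for \<psi> x
    using nonneg[OF that(1), of x] that(2) by (simp add: normalise_def field_simps)
  have le: "\<phi> x \<le> norm x" if "\<phi> \<in> \<Phi>" for \<phi> x
    using that normalise_le unfolding \<Phi>_def by auto
  have lin: "linear \<phi>" if "\<phi> \<in> \<Phi>" for \<phi>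
  proof -
    have "linear (normalise \<psi>)" if \<psi>: "\<psi> \<in> \<Psi>" for \<psi>
    proof (rule linearI)
      show "normalise \<psi> (x + y) = normalise \<psi> x + normalise \<psi> y" for x y
        using linear_add[OF \<Psi>(2)[OF \<psi>], of "(x, 0)" "(y, 0)"]
        by (simp add: normalise_def add_divide_distrib diff_divide_distrib)
    qed (simp add: normalise_def scale[OF \<psi>])
    then show ?thesis using that unfolding \<Phi>_def by (auto intro: linear_zero)
  qed
  have "\<exists>\<phi>\<in>\<Phi>. \<phi> x = norm x" for x
  proof (rule ccontr)
    assume "\<not> ?thesis"
    then have less: "\<phi> x < norm x" if "\<phi> \<in> \<Phi>" for \<phi> using le[OF that, of x] that by force
    have "\<Phi> \<noteq> {}" by (simp add: \<Phi>_def)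
    define m where "m = Max ((\<lambda>\<phi>. \<phi> x) ` \<Phi>)"
    have m: "\<phi> x \<le> m" if "\<phi> \<in> \<Phi>" for \<phi> unfolding m_def using that fin by (intro Max_ge) auto
    have "m < norm x" unfolding m_def using fin less \<open>\<Phi> \<noteq> {}\<close> by (subst Max_less_iff) auto
    moreover have "0 \<le> m" using m[of "\<lambda>_. 0"] by (simp add: \<Phi>_def)
    ultimately obtain r where r: "0 < r" "m < r" "r < norm x"
      using dense by (metis le_less_trans)
    have "0 \<le> inverse r * \<psi> (x, 0) + \<psi> (0, 1)" if \<psi>: "\<psi> \<in> \<Psi>" for \<psi>
    proof (cases "\<psi> (0, 1) = 0")
      case True
      then show ?thesis using nonneg[OF \<psi>, of x] r(1) by simp
    next
      case False
      then have pos: "0 < \<psi> (0, 1)" using c[OF \<psi>] by simp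
      then have "normalise \<psi> x \<le> m" using \<psi> by (intro m) (auto simp: \<Phi>_def)
      then have "- \<psi> (x, 0) \<le> r * \<psi> (0, 1)"
        using pos r(2) unfolding normalise_def by (simp add: field_simps) (smt (verit) mult_right_mono)
      then show ?thesis using r(1) by (simp add: field_simps)
    qed
    then have "norm (inverse r *\<^sub>R x) \<le> 1" unfolding ball using scale by simp
    then show False using r by (simp add: field_simps)
  qed
  then show thesis using that[of \<Phi>] fin lin le by blast
qed

section \<open>Finite-dimensional spaces with polyhedral norm\<close>

text \<open>
A quantitative open mapping statement for finitely many functionals: if their values at \<open>x\<close> are
small, then a small vector has the same values. By induction, either the new functional vanishes on the
common kernel of the others and is matched automatically, or a vector \<open>u\<close> in this kernel allows its
value to be adjusted separately.
\<close>

lemma bounded_correction: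
  fixes \<Phi> :: "('a::real_normed_vector \<Rightarrow> real) set"
  assumes "finite \<Phi>" and "\<And>\<phi>. \<phi> \<in> \<Phi> \<Longrightarrow> bounded_linear \<phi>"
  shows "\<exists>C\<ge>0. \<forall>x D. 0 \<le> D \<and> (\<forall>\<phi>\<in>\<Phi>. \<bar>\<phi> x\<bar> \<le> D) \<longrightarrow>
    (\<exists>z. (\<forall>\<phi>\<in>\<Phi>. \<phi> z = \<phi> x) \<and> norm z \<le> C * D)"
  using assms
proof (induction \<Phi>)
  case empty
  show ?case by (intro exI[of _ 0]) (auto intro: exI[of _ 0])
next
  case (insert \<phi> \<Phi>)
  obtain C where C: "C \<ge> 0" and IH: "\<And>x D. 0 \<le> D \<Longrightarrow> (\<And>\<psi>. \<psi> \<in> \<Phi> \<Longrightarrow> \<bar>\<psi> x\<bar> \<le> D) \<Longrightarrow>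
      \<exists>z. (\<forall>\<psi>\<in>\<Phi>. \<psi> z = \<psi> x) \<and> norm z \<le> C * D"
    using insert by (metis insertI2)
  interpret \<phi>: bounded_linear \<phi> using insert.prems by blast
  show ?case
  proof (cases "\<exists>u. (\<forall>\<psi>\<in>\<Phi>. \<psi> u = 0) \<and> \<phi> u \<noteq> 0")
    case False
    have "\<exists>z. (\<forall>\<psi>\<in>insert \<phi> \<Phi>. \<psi> z = \<psi> x) \<and> norm z \<le> C * D"
      if D: "0 \<le> D" "\<forall>\<psi>\<in>insert \<phi> \<Phi>. \<bar>\<psi> x\<bar> \<le> D" for x D
    proof -
      obtain z where z: "\<forall>\<psi>\<in>\<Phi>. \<psi> z = \<psi> x" "norm z \<le> C * D" using IH[of D x] D by auto
      have "\<psi> (x - z) = 0" if "\<psi> \<in> \<Phi>" for \<psi>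
        using z(1)[rule_format, OF that] that insert.prems[of \<psi>] linear_simps(2)[of \<psi> x z] by simp
      then have "\<phi> (x - z) = 0" using False by blast
      then have "\<phi> z = \<phi> x" by (simp add: \<phi>.diff)
      then show ?thesis using z by auto
    qed
    then show ?thesis using C by blast
  next
    case True
    then obtain u' where u': "\<forall>\<psi>\<in>\<Phi>. \<psi> u' = 0" "\<phi> u' \<noteq> 0" by blast
    define u where "u = inverse (\<phi> u') *\<^sub>R u'"
    have u0: "\<psi> u = 0" if "\<psi> \<in> \<Phi>" for \<psi>
      using u'(1)[rule_format, OF that] that insert.prems[of \<psi>] linear_simps(5)[of \<psi>] by (simp add: u_def)
    have u1: "\<phi> u = 1" using u'(2) by (simp add: u_def \<phi>.scaleR)
    obtain K where K: "K \<ge> 0" "\<And>x. \<bar>\<phi> x\<bar> \<le> norm x * K" using \<phi>.nonneg_bounded by auto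
    define C' where "C' = C + (1 + C * K) * norm u"
    have "\<exists>z. (\<forall>\<psi>\<in>insert \<phi> \<Phi>. \<psi> z = \<psi> x) \<and> norm z \<le> C' * D"
      if D: "0 \<le> D" "\<forall>\<psi>\<in>insert \<phi> \<Phi>. \<bar>\<psi> x\<bar> \<le> D" for x D
    proof -
      obtain z where z: "\<forall>\<psi>\<in>\<Phi>. \<psi> z = \<psi> x" "norm z \<le> C * D" using IH[of D x] D by auto
      define z' where "z' = z + (\<phi> x - \<phi> z) *\<^sub>R u"
      have "\<psi> z' = \<psi> x" if "\<psi> \<in> \<Phi>" for \<psi>
        using z(1)[rule_format, OF that] that u0[OF that] insert.prems[of \<psi>] linear_simps(1,5)[of \<psi>]
        by (simp add: z'_def)
      moreover have "\<phi> z' = \<phi> x" by (simp add: z'_def \<phi>.add \<phi>.scaleR u1)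
      moreover have "norm z' \<le> C' * D"
      proof -
        have "\<bar>\<phi> z\<bar> \<le> (C * D) * K" using K(2)[of z] z(2) K(1) by (meson mult_right_mono order_trans)
        then have "\<bar>\<phi> x - \<phi> z\<bar> \<le> (1 + C * K) * D" using D(2) by (auto simp: algebra_simps)
        then have "\<bar>\<phi> x - \<phi> z\<bar> * norm u \<le> (1 + C * K) * D * norm u" by (rule mult_right_mono) simp
        moreover have "norm z' \<le> norm z + \<bar>\<phi> x - \<phi> z\<bar> * norm u"
          using norm_triangle_ineq[of z "(\<phi> x - \<phi> z) *\<^sub>R u"] by (simp add: z'_def)
        ultimately show ?thesis using z(2) by (simp add: C'_def algebra_simps)
      qed
      ultimately show ?thesis by auto
    qed
    moreover have "C' \<ge> 0" using C K by (simp add: C'_def)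
    ultimately show ?thesis by blast
  qed
qed

text \<open>
A substitute for passing to a subsequence along which every gap either stays bounded or tends to
infinity: take \<open>I\<close> of maximal cardinality among the index sets whose gaps can be kept bounded
arbitrarily far out.
\<close>

lemma bounded_gap_index_set:
  fixes S :: "'a::real_normed_vector set" and gap :: "'i \<Rightarrow> 'a \<Rightarrow> real"
  assumes fin: "finite \<Phi>" and unbounded: "\<not> bounded S"
  obtains I C where "I \<subseteq> \<Phi>" "C \<ge> 0"
    "\<And>M. \<exists>x\<in>S. M \<le> norm x \<and> (\<forall>i\<in>I. gap i x \<le> C) \<and> (\<forall>i\<in>\<Phi> - I. M < gap i x)"
proof -
  define good where "good I \<longleftrightarrow> I \<subseteq> \<Phi> \<and>
    (\<exists>C\<ge>0. \<forall>M. \<exists>x\<in>S. M \<le> norm x \<and> (\<forall>i\<in>I. gap i x \<le> C))" for I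
  have "\<exists>x\<in>S. M \<le> norm x" for M using unbounded unfolding bounded_iff by (meson linear)
  then have "good {}" unfolding good_def by auto
  moreover have "\<forall>I. good I \<longrightarrow> card I < Suc (card \<Phi>)"
    unfolding good_def using card_mono[OF fin] by (auto simp: less_Suc_eq_le)
  ultimately obtain I where I: "good I" and max: "\<And>J. good J \<Longrightarrow> card J \<le> card I"
    using ex_has_greatest_nat[of good "{}" card "Suc (card \<Phi>)"] by blast
  obtain C where C: "I \<subseteq> \<Phi>" "C \<ge> 0" "\<And>M. \<exists>x\<in>S. M \<le> norm x \<and> (\<forall>i\<in>I. gap i x \<le> C)"
    using I unfolding good_def by blast
  have "\<exists>x\<in>S. M \<le> norm x \<and> (\<forall>i\<in>I. gap i x \<le> C) \<and> (\<forall>i\<in>\<Phi> - I. M < gap i x)" for M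
  proof -
    \<comment> \<open>At least \<open>C\<close>, so that gaps below \<open>C\<close> qualify, and at least the required gap \<open>M\<close>.\<close>
    define C' where "C' = max C M"
    have "\<exists>B. \<forall>x\<in>S. B \<le> norm x \<and> (\<forall>j\<in>I. gap j x \<le> C') \<longrightarrow> C' < gap i x" if i: "i \<in> \<Phi> - I" for i
    proof (rule ccontr)
      assume *: "\<not> ?thesis"
      have "\<exists>x\<in>S. B \<le> norm x \<and> (\<forall>j\<in>insert i I. gap j x \<le> C')" for B
        using * by (auto simp: not_less)
      moreover have "C' \<ge> 0" using C(2) by (simp add: C'_def)
      ultimately have "good (insert i I)" unfolding good_def using C(1) i by blast
      then have "card (insert i I) \<le> card I" by (rule max)
      then show False using i finite_subset[OF C(1) fin] by simp
    qed
    then obtain B where B: "\<And>i x. i \<in> \<Phi> - I \<Longrightarrow> x \<in> S \<Longrightarrow> B i \<le> norm x \<Longrightarrow>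
        (\<And>j. j \<in> I \<Longrightarrow> gap j x \<le> C') \<Longrightarrow> C' < gap i x"
      by metis
    define N where "N = Max (insert M (B ` (\<Phi> - I)))"
    have N: "M \<le> N" "\<And>i. i \<in> \<Phi> - I \<Longrightarrow> B i \<le> N"
      unfolding N_def using fin by (auto intro!: Max_ge)
    obtain x where x: "x \<in> S" "N \<le> norm x" "\<forall>i\<in>I. gap i x \<le> C" using C(3) by blast
    have "C' < gap i x" if "i \<in> \<Phi> - I" for i
      using that x N(2)[OF that] by (intro B) (auto simp: C'_def)
    then have "\<forall>i\<in>\<Phi> - I. M < gap i x" by (force simp: C'_def)
    then show ?thesis using x N(1) by force
  qed
  then show thesis using that C(1,2) by blast
qed

text \<open>
Let \<open>I\<close> be the set of those functionals \<open>\<phi> \<in> \<Phi>\<close> for which \<open>\<parallel>x\<parallel> - \<phi> x\<close> stays bounded as \<open>x\<close> goes to infinity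
in a suitable part of \<open>F_\<delta>\<close>. A bounded correction of such an \<open>x\<close> and normalisation yield a unit
vector \<open>e\<close> at which precisely the functionals in \<open>I\<close> attain the norm. Then for every \<open>t\<close> and far enough
\<open>x\<close> each \<open>\<phi> \<in> I\<close> norms \<open>x - t e\<close> up to a constant, so dissipativity bounds \<open>\<phi> (f (t e) - t e)\<close> below. Every
element of the duality map of \<open>e\<close> dominates at each point one of the functionals in \<open>I\<close>, so (e) fails at \<open>e\<close>.
\<close>

lemma polyhedral_radially_inward_imp_bounded_approx:
  fixes f :: "'a::real_normed_vector \<Rightarrow> 'a"
  assumes fd: "finite_dimensional_space TYPE('a)" and poly: "polyhedral_norm TYPE('a)"
    and f: "nonexpansive_on UNIV f" and inward: "displacement_radially_inward f"
  shows "approx_fixed_points_bounded f"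
  unfolding approx_fixed_points_bounded_def
proof (intro allI impI, rule ccontr)
  fix \<delta> :: real assume "\<delta> > 0" and unbounded: "\<not> bounded (approx_fixed_points \<delta> f)"
  obtain \<Phi> :: "('a \<Rightarrow> real) set" where fin: "finite \<Phi>" and lin: "\<And>\<phi>. \<phi> \<in> \<Phi> \<Longrightarrow> linear \<phi>"
    and le: "\<And>\<phi> x. \<phi> \<in> \<Phi> \<Longrightarrow> \<phi> x \<le> norm x" and att: "\<And>x. \<exists>\<phi>\<in>\<Phi>. \<phi> x = norm x"
    using polyhedral_norm_eq_Max[OF fd poly] by blast
  have ge: "- norm x \<le> \<phi> x" if "\<phi> \<in> \<Phi>" for \<phi> x
    using le[OF that, of "- x"] linear_neg[OF lin[OF that], of x] by simp
  obtain I C where I: "I \<subseteq> \<Phi>" and C: "C \<ge> 0"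
    and far: "\<And>M. \<exists>x\<in>approx_fixed_points \<delta> f. M \<le> norm x \<and>
      (\<forall>\<phi>\<in>I. norm x - \<phi> x \<le> C) \<and> (\<forall>\<phi>\<in>\<Phi> - I. M < norm x - \<phi> x)"
    using bounded_gap_index_set[OF fin unbounded, of "\<lambda>\<phi> x. norm x - \<phi> x"] by blast
  obtain \<phi>0 where \<phi>0: "\<phi>0 \<in> I"
  proof -
    obtain x where "\<forall>\<phi>\<in>\<Phi> - I. 0 < norm x - \<phi> x" using far[of 0] by blast
    then show thesis using att[of x] that by force
  qed
  have blin: "bounded_linear (\<lambda>x. \<phi> x - \<phi>0 x)" if "\<phi> \<in> I" for \<phi>
  proof (rule bounded_linear_intro[where K = 2])
    have l: "linear \<phi>" "linear \<phi>0" "\<phi> \<in> \<Phi>" "\<phi>0 \<in> \<Phi>" using lin I that \<phi>0 by auto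
    show "\<phi> (x + y) - \<phi>0 (x + y) = \<phi> x - \<phi>0 x + (\<phi> y - \<phi>0 y)" for x y
      using l by (simp add: linear_add)
    show "\<phi> (r *\<^sub>R x) - \<phi>0 (r *\<^sub>R x) = r *\<^sub>R (\<phi> x - \<phi>0 x)" for r x
      using l by (simp add: linear_scale algebra_simps)
    show "norm (\<phi> x - \<phi>0 x) \<le> norm x * 2" for x
      using le[OF l(3), of x] le[OF l(4), of x] ge[OF l(3), of x] ge[OF l(4), of x] by auto
  qed
  obtain c where c: "c \<ge> 0" and corr: "\<And>x. (\<forall>\<phi>\<in>I. \<bar>\<phi> x - \<phi>0 x\<bar> \<le> C) \<Longrightarrow>
      \<exists>z. (\<forall>\<phi>\<in>I. \<phi> z - \<phi>0 z = \<phi> x - \<phi>0 x) \<and> norm z \<le> c"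
  proof -
    obtain c' where "c' \<ge> 0" "\<forall>x D. 0 \<le> D \<and> (\<forall>\<psi>\<in>(\<lambda>\<phi> x. \<phi> x - \<phi>0 x) ` I. \<bar>\<psi> x\<bar> \<le> D) \<longrightarrow>
        (\<exists>z. (\<forall>\<psi>\<in>(\<lambda>\<phi> x. \<phi> x - \<phi>0 x) ` I. \<psi> z = \<psi> x) \<and> norm z \<le> c' * D)"
      using bounded_correction[of "(\<lambda>\<phi> x. \<phi> x - \<phi>0 x) ` I"] finite_subset[OF I fin] blin by blast
    then show thesis using that[of "c' * C"] C by simp
  qed
  obtain e where e: "norm e = 1" "\<And>\<phi>. \<phi> \<in> I \<Longrightarrow> \<phi> e = 1" "\<And>\<phi>. \<phi> \<in> \<Phi> - I \<Longrightarrow> \<phi> e < 1"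
  proof -
    \<comment> \<open>The correction changes each functional by at most \<open>c\<close>, so a gap above \<open>C + 2 * c\<close> keeps the
      functionals outside \<open>I\<close> strictly below those in \<open>I\<close>.\<close>
    obtain x where x: "C + 2 * c + 1 \<le> norm x" "\<forall>\<phi>\<in>I. norm x - \<phi> x \<le> C"
      "\<forall>\<phi>\<in>\<Phi> - I. C + 2 * c + 1 < norm x - \<phi> x"
      using far by blast
    have "\<bar>\<phi> x - \<phi>0 x\<bar> \<le> C" if "\<phi> \<in> I" for \<phi>
    proof -
      have "\<phi> x \<le> norm x" "\<phi>0 x \<le> norm x" using le I that \<phi>0 by auto
      moreover have "norm x - \<phi> x \<le> C" "norm x - \<phi>0 x \<le> C" using x(2) that \<phi>0 by auto
      ultimately show ?thesis by linarith
    qed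
    then obtain z where z: "\<forall>\<phi>\<in>I. \<phi> z - \<phi>0 z = \<phi> x - \<phi>0 x" "norm z \<le> c" using corr by blast
    define y where "y = x - z"
    have diff: "\<phi> y = \<phi> x - \<phi> z" if "\<phi> \<in> \<Phi>" for \<phi>
      unfolding y_def using lin[OF that] by (rule linear_diff)
    have eq: "\<phi> y = \<phi>0 y" if "\<phi> \<in> I" for \<phi>
      using z(1) that diff[of \<phi>] diff[of \<phi>0] I \<phi>0 by force
    have lower: "norm x - C - c \<le> \<phi>0 y"
      using x(2) \<phi>0 diff[of \<phi>0] le[of \<phi>0 z] z(2) I by force
    have upper: "\<phi> y < norm x - C - c" if "\<phi> \<in> \<Phi> - I" for \<phi>
      using x(3) that diff[of \<phi>] ge[of \<phi> z] z(2) by force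
    obtain \<phi>1 where "\<phi>1 \<in> \<Phi>" "\<phi>1 y = norm y" using att by blast
    then have ny: "norm y = \<phi>0 y"
      using eq[of \<phi>1] upper[of \<phi>1] lower le[of \<phi>0 y] I \<phi>0 by force
    have pos: "norm y > 0" using ny lower x(1) c by linarith
    have sc: "\<phi> (inverse (norm y) *\<^sub>R y) = \<phi> y / norm y" if "\<phi> \<in> \<Phi>" for \<phi>
      using linear_scale[OF lin[OF that]] by (simp add: divide_inverse mult.commute)
    show thesis
    proof (rule that[of "inverse (norm y) *\<^sub>R y"])
      show "norm (inverse (norm y) *\<^sub>R y) = 1" using pos by simp
      show "\<phi> (inverse (norm y) *\<^sub>R y) = 1" if "\<phi> \<in> I" for \<phi>
        using sc[of \<phi>] eq[OF that] ny pos I that by auto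
      show "\<phi> (inverse (norm y) *\<^sub>R y) < 1" if "\<phi> \<in> \<Phi> - I" for \<phi>
        using sc[of \<phi>] upper[OF that] lower ny pos that by auto
    qed
  qed
  have face: "- \<delta> - C \<le> \<phi> (f (t *\<^sub>R e) - t *\<^sub>R e)" if \<phi>: "\<phi> \<in> I" and t: "t \<ge> 0" for \<phi> t
  proof -
    have \<phi>\<Phi>: "\<phi> \<in> \<Phi>" using I \<phi> by blast
    \<comment> \<open>Subtracting \<open>t e\<close> lowers the functionals in \<open>I\<close> by \<open>t\<close> and raises the others by at most \<open>t\<close>, so a
      gap of \<open>2 * t\<close> preserves the comparison.\<close>
    obtain x where x: "norm (f x - x) \<le> \<delta>" "\<forall>\<psi>\<in>I. norm x - \<psi> x \<le> C"
      "\<forall>\<psi>\<in>\<Phi> - I. 2 * t < norm x - \<psi> x"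
      using far[of "2 * t"] unfolding approx_fixed_points_def by blast
    have te: "\<psi> (y - t *\<^sub>R e) = \<psi> y - t * \<psi> e" if "\<psi> \<in> \<Phi>" for \<psi> y
      using lin[OF that] by (simp add: linear_diff linear_scale)
    obtain \<psi> where \<psi>: "\<psi> \<in> \<Phi>" "\<psi> (x - t *\<^sub>R e) = norm (x - t *\<^sub>R e)" using att by blast
    have "norm (x - t *\<^sub>R e) \<le> norm x - t"
    proof (cases "\<psi> \<in> I")
      case True
      then show ?thesis using \<psi> te[OF \<psi>(1), of x] e(2)[OF True] le[OF \<psi>(1), of x] by simp
    next
      case False
      have "t * (- 1) \<le> t * \<psi> e" using ge[OF \<psi>(1), of e] e(1) t by (intro mult_left_mono) auto
      then show ?thesis using \<psi> te[OF \<psi>(1), of x] x(3) False by force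
    qed
    moreover have "\<phi> (f x - f (t *\<^sub>R e)) \<le> norm (x - t *\<^sub>R e)"
      using le[OF \<phi>\<Phi>] nonexpansiveD[OF f] by (rule order_trans)
    moreover have "norm x - \<phi> x \<le> C" using x(2) \<phi> by blast
    moreover have "- \<delta> \<le> \<phi> (f x - x)" using ge[OF \<phi>\<Phi>, of "f x - x"] x(1) by linarith
    ultimately show ?thesis
      using te[OF \<phi>\<Phi>, of "f (t *\<^sub>R e)"] e(2)[OF \<phi>] linear_diff[OF lin[OF \<phi>\<Phi>]] by simp
  qed
  have below: "\<exists>\<phi>\<in>I. \<phi> y \<le> blinfun_apply w y" if w: "w \<in> duality_map e" for w y
  proof -
    have "\<exists>s. \<forall>\<phi>\<in>\<Phi> - I. 2 * norm y < s * (1 - \<phi> e)"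
    proof -
      define s where "s = Max (insert 0 ((\<lambda>\<phi>. (2 * norm y + 1) / (1 - \<phi> e)) ` (\<Phi> - I)))"
      have "2 * norm y < s * (1 - \<phi> e)" if \<phi>: "\<phi> \<in> \<Phi> - I" for \<phi>
      proof -
        have "(2 * norm y + 1) / (1 - \<phi> e) \<le> s"
          unfolding s_def using fin \<phi> by (intro Max_ge) auto
        then show ?thesis using e(3)[OF \<phi>] by (simp add: field_simps)
      qed
      then show ?thesis by blast
    qed
    then obtain s where s: "\<And>\<phi>. \<phi> \<in> \<Phi> - I \<Longrightarrow> 2 * norm y < s * (1 - \<phi> e)" by blast
    obtain \<phi> where \<phi>: "\<phi> \<in> \<Phi>" "\<phi> (s *\<^sub>R e - y) = norm (s *\<^sub>R e - y)" using att by blast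
    have se: "\<psi> (s *\<^sub>R e - y) = s * \<psi> e - \<psi> y" if "\<psi> \<in> \<Phi>" for \<psi>
      using lin[OF that] by (simp add: linear_diff linear_scale)
    have I\<phi>: "\<phi> \<in> I"
    proof (rule ccontr)
      assume "\<phi> \<notin> I"
      then have "2 * norm y < s - s * \<phi> e" using s[of \<phi>] \<phi>(1) by (simp add: algebra_simps)
      moreover have "\<phi>0 (s *\<^sub>R e - y) \<le> \<phi> (s *\<^sub>R e - y)" using le[of \<phi>0] \<phi> I \<phi>0 by auto
      moreover have "\<phi>0 y \<le> norm y" "- norm y \<le> \<phi> y" using le[of \<phi>0 y] ge[OF \<phi>(1), of y] I \<phi>0 by auto
      ultimately show False using se[OF \<phi>(1)] se[of \<phi>0] e(2)[OF \<phi>0] I \<phi>0 by force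
    qed
    have "norm w \<le> 1" "w e = 1" using w duality_map_unit_iff[OF e(1)] by auto
    then have "s - w y \<le> norm (s *\<^sub>R e - y)"
      using blinfun_apply_le(1)[of w "s *\<^sub>R e - y"] by (simp add: blinfun.diff_right blinfun.scaleR_right)
    then have "\<phi> y \<le> w y" using \<phi> se[OF \<phi>(1)] e(2)[OF I\<phi>] by simp
    then show ?thesis using I\<phi> by blast
  qed
  obtain w where w: "w \<in> duality_map e"
    "\<And>M. \<exists>t\<ge>0. blinfun_apply w (f (t *\<^sub>R e) - t *\<^sub>R e) \<le> M"
    using inward e(1) unfolding displacement_radially_inward_iff[OF f] by blast
  obtain t where t: "t \<ge> 0" "blinfun_apply w (f (t *\<^sub>R e) - t *\<^sub>R e) \<le> - \<delta> - C - 1"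
    using w(2) by blast
  obtain \<phi> where "\<phi> \<in> I" "\<phi> (f (t *\<^sub>R e) - t *\<^sub>R e) \<le> blinfun_apply w (f (t *\<^sub>R e) - t *\<^sub>R e)"
    using below[OF w(1)] by blast
  then show False using face[of \<phi> t] t by force
qed

section \<open>Comparison of the five conditions\<close>

theorem theorem3p7:
  fixes f :: "'a::banach \<Rightarrow> 'a"
  assumes "nonexpansive_on UNIV f"
  shows
    "((approx_fixed_points_bounded f \<longrightarrow> displacement_dense_range f) \<and>
      (translates_have_bounded_fixed_points f \<longrightarrow> displacement_onto f) \<and>
      (displacement_dense_range f \<longrightarrow> displacement_radially_inward f)) \<and>
     (fixed_point_property TYPE('a) \<longrightarrow>
        (approx_fixed_points_bounded f \<longrightarrow> translates_have_bounded_fixed_points f)) \<and>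
     (uniformly_smooth_space TYPE('a) \<longrightarrow>
        (displacement_dense_range f \<longleftrightarrow> displacement_radially_inward f)) \<and>
     (hilbert_space TYPE('a) \<longrightarrow>
        (translates_have_bounded_fixed_points f \<longleftrightarrow> displacement_onto f)) \<and>
     (finite_dimensional_space TYPE('a) \<and>
        (smooth_space TYPE('a) \<or> polyhedral_norm TYPE('a)) \<longrightarrow>
        (approx_fixed_points_bounded f \<longleftrightarrow> translates_have_bounded_fixed_points f) \<and>
        (translates_have_bounded_fixed_points f \<longleftrightarrow> displacement_onto f) \<and>
        (displacement_onto f \<longleftrightarrow> displacement_dense_range f) \<and>
        (displacement_dense_range f \<longleftrightarrow> displacement_radially_inward f))"
proof -
  note f = assms
  have ad: "approx_fixed_points_bounded f \<longrightarrow> displacement_dense_range f"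
    using bounded_approx_imp_dense_range[OF f] by blast
  have bc: "translates_have_bounded_fixed_points f \<longrightarrow> displacement_onto f"
    using fixed_points_imp_displacement_onto by blast
  have de: "displacement_dense_range f \<longrightarrow> displacement_radially_inward f"
    using dense_range_imp_radially_inward[OF f] by blast
  have ab: "approx_fixed_points_bounded f \<longrightarrow> translates_have_bounded_fixed_points f"
    if "fixed_point_property TYPE('a)"
    using bounded_approx_imp_fixed_points[OF that f] by blast
  have ed: "displacement_radially_inward f \<longrightarrow> displacement_dense_range f"
    if "uniformly_smooth_space TYPE('a)"
    using radially_inward_imp_dense_range[OF that f] by blast
  have cb: "displacement_onto f \<longrightarrow> translates_have_bounded_fixed_points f"
    if "hilbert_space TYPE('a)"
    using hilbert_displacement_onto_imp_fixed_points[OF that f] by blast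
  have ea: "displacement_radially_inward f \<longrightarrow> approx_fixed_points_bounded f"
    if "finite_dimensional_space TYPE('a)" "smooth_space TYPE('a) \<or> polyhedral_norm TYPE('a)"
    using that smooth_radially_inward_imp_bounded_approx[OF that(1) _ f]
      polyhedral_radially_inward_imp_bounded_approx[OF that(1) _ f] by blast
  have cd: "displacement_onto f \<longrightarrow> displacement_dense_range f"
    using displacement_onto_imp_dense_range by blast
  have fd: "fixed_point_property TYPE('a)" if "finite_dimensional_space TYPE('a)"
    using finite_dimensional_fixed_point_property[OF that] .
  show ?thesis
    using ad bc de ab ed cb ea cd fd by (intro conjI impI iffI) blast+
qed

end
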